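(* Let $1\le p<\infty$, let $X$ be a pointed metric space and $E$ a Banach space, and let $T\in Lip_0(X;E)$. The following are equivalent. (1) $T$ belongs to $\Pi_p^{SL}(X;E)$, i.e. $T$ is strictly Lipschitz $p$-summing. (2) The linearization $\widehat{T}$ belongs to $\Pi_p(\mathcal{F}(X);E)$, i.e. $\widehat T$ is $p$-summing.
   Context: All spaces are real. A pointed metric space is a metric space $X$ with a distinguished point $0$. $Lip_0(X;E)$ is the Banach space of Lipschitz maps $T:X\to E$ with $T(0)=0$, normed by the best Lipschitz constant $Lip(T)$; $X^{\#}=Lip_0(X;\mathbb{R})$. For $x,y\in X$, $\delta_{(x,y)}:X^{\#}\to\mathbb{R}$ is $\delta_{(x,y)}(f)=f(x)-f(y)$. $\mathcal{F}(X)$ is the completion of the linear span of the $\delta_{(x,y)}$ under $\|m\|_{\mathcal{F}(X)}=\inf\{\sum_i|\lambda_i|d(x_i,y_i): m=\sum_i\lambda_i\delta_{(x_i,y_i)}\}$. Put $\delta_X(x)=\delta_{(x,0)}$. The linearization of $T\in Lip_0(X;E)$ is the unique bounded linear $\widehat{T}:\mathcal{F}(X)\to E$ with $\widehat{T}\circ\delta_X=T$. Let $p^*$ be the conjugate exponent of $p$. For a finite sequence in a Banach space $F$ put $\|(x_i)\|_{l_p^n(F)}=(\sum_i\|x_i\|^p)^{1/p}$ (max for $p=\infty$) and $\|(x_i)\|_{l_p^{n,w}(F)}=\sup_{\|x^*\|\le 1}(\sum_i|x^*(x_i)|^p)^{1/p}$. For $u\in F\otimes G$ ($F,G$ Banach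 spaces), $$d_p(u)=\inf\Big\{\|(x_i)\|_{l_p^{n,w}(F)}\|(g_i)\|_{l_{p^*}^n(G)}: u=\sum_{i=1}^n x_i\otimes g_i\Big\}.$$ A linear operator $S:F\to G$ is $p$-summing, $S\in\Pi_p(F;G)$, if there is $C>0$ with $|\sum_{i=1}^n\langle S(x_i),g_i^*\rangle|\le C\,d_p(\sum_{i=1}^n x_i\otimes g_i^* )$ for all $x_i\in F$, $g_i^*\in G^*$. $X\boxtimes E^*$ is the linear span of the functionals $\delta_{(x,y)}\boxtimes e^*$ on $Lip_0(X;E^{**})$ given by $(\delta_{(x,y)}\boxtimes e^* )(f)=\langle f(x)-f(y),e^*\rangle$. For $u=\sum_i\delta_{(x_i,y_i)}\boxtimes e_i^*\in X\boxtimes E^*$, put $d_p^L(u)=d_p(\Phi(u))$ where $\Phi(u)=\sum_i\delta_{(x_i,y_i)}\otimes e_i^*\in\mathcal{F}(X)\otimes E^*$. A map $T\in Lip_0(X;E)$ is strictly Lipschitz $p$-summing, $T\in\Pi_p^{SL}(X;E)$, if there is $C>0$ such that for all $x_i,y_i\in X$, $e_i^*\in E^*$ ($1\le i\le n$), $$\Big|\sum_{i=1}^n\langle T(x_i)-T(y_i),e_i^*\rangle\Big|\le C\,d_p^L\Big(\sum_{i=1}^n\delta_{(x_i,y_i)}\boxtimes e_i^*\Big).$$ *)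

theory Defs
  imports "HOL-Analysis.Analysis" "HOL-Library.Function_Algebras"
begin

section \<open>Functions into a vector space as a vector space\<close>

instantiation "fun" :: (type, real_vector) real_vector
begin

definition scaleR_fun :: "real \<Rightarrow> ('a \<Rightarrow> 'b) \<Rightarrow> 'a \<Rightarrow> 'b"
  where "scaleR_fun r f = (\<lambda>x. r *\<^sub>R f x)"

instance
  by standard (auto simp: scaleR_fun_def fun_eq_iff scaleR_add_right scaleR_add_left)

end

lemma scaleR_fun_apply [simp]: "(r *\<^sub>R f) x = r *\<^sub>R f x"
  by (simp add: scaleR_fun_def)

lemma sum_lessThan_append:
  fixes f g :: "nat \<Rightarrow> 'a::comm_monoid_add"
  shows "(\<Sum>i<m + n. if i < m then f i else g (i - m)) = (\<Sum>i<m. f i) + (\<Sum>i<n. g i)"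
proof (induction n)
  case 0
  then show ?case by simp
next
  case (Suc n)
  then show ?case by (simp add: add.assoc)
qed

section \<open>Completion of a normed space\<close>

text \<open>Cauchy sequences modulo null sequences.\<close>

definition completion_rel :: "(nat \<Rightarrow> 'a::real_normed_vector) \<Rightarrow> (nat \<Rightarrow> 'a) \<Rightarrow> bool"
  where "completion_rel X Y \<longleftrightarrow> Cauchy X \<and> Cauchy Y \<and> (\<lambda>n. X n - Y n) \<longlonglongrightarrow> 0"

lemma Cauchy_add':
  fixes X Y :: "nat \<Rightarrow> 'a::real_normed_vector"
  assumes "Cauchy X" "Cauchy Y" shows "Cauchy (\<lambda>n. X n + Y n)"
proof (rule metric_CauchyI)
  fix e :: real assume "0 < e"
  then have e: "0 < e / 2" by simp
  obtain M where M: "\<And>m n. m \<ge> M \<Longrightarrow> n \<ge> M \<Longrightarrow> dist (X m) (X n) < e / 2"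
    using metric_CauchyD[OF assms(1) e] by blast
  obtain N where N: "\<And>m n. m \<ge> N \<Longrightarrow> n \<ge> N \<Longrightarrow> dist (Y m) (Y n) < e / 2"
    using metric_CauchyD[OF assms(2) e] by blast
  show "\<exists>M. \<forall>m\<ge>M. \<forall>n\<ge>M. dist (X m + Y m) (X n + Y n) < e"
  proof (intro exI allI impI)
    fix m n assume "m \<ge> max M N" "n \<ge> max M N"
    then have "dist (X m) (X n) < e / 2" "dist (Y m) (Y n) < e / 2" using M N by auto
    moreover have "dist (X m + Y m) (X n + Y n) \<le> dist (X m) (X n) + dist (Y m) (Y n)"
      by (rule dist_triangle_add)
    ultimately show "dist (X m + Y m) (X n + Y n) < e" by linarith
  qed
qed

lemma Cauchy_scaleR':
  fixes X :: "nat \<Rightarrow> 'a::real_normed_vector"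
  assumes "Cauchy X" shows "Cauchy (\<lambda>n. r *\<^sub>R X n)"
  using bounded_linear.Cauchy[OF bounded_linear_scaleR_right assms] .

lemma Cauchy_uminus':
  fixes X :: "nat \<Rightarrow> 'a::real_normed_vector"
  assumes "Cauchy X" shows "Cauchy (\<lambda>n. - X n)"
  using Cauchy_scaleR'[OF assms, of "-1"] by simp

lemma Cauchy_diff':
  fixes X Y :: "nat \<Rightarrow> 'a::real_normed_vector"
  assumes "Cauchy X" "Cauchy Y" shows "Cauchy (\<lambda>n. X n - Y n)"
  using Cauchy_add'[OF assms(1) Cauchy_uminus'[OF assms(2)]] by simp

lemma Cauchy_convergent_norm:
  fixes X :: "nat \<Rightarrow> 'a::real_normed_vector"
  assumes "Cauchy X" shows "convergent (\<lambda>n. norm (X n))"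
proof -
  have "Cauchy (\<lambda>n. norm (X n))"
  proof (rule metric_CauchyI)
    fix e :: real assume "0 < e"
    then obtain M where M: "\<And>m n. m \<ge> M \<Longrightarrow> n \<ge> M \<Longrightarrow> dist (X m) (X n) < e"
      using metric_CauchyD[OF assms] by blast
    show "\<exists>M. \<forall>m\<ge>M. \<forall>n\<ge>M. dist (norm (X m)) (norm (X n)) < e"
    proof (intro exI allI impI)
      fix m n assume "m \<ge> M" "n \<ge> M"
      then have "norm (X m - X n) < e" using M by (simp add: dist_norm)
      then show "dist (norm (X m)) (norm (X n)) < e"
        using norm_triangle_ineq3[of "X m" "X n"] by (simp add: dist_real_def)
    qed
  qed
  then show ?thesis by (simp add: Cauchy_convergent_iff)
qed

quotient_type (overloaded) 'a completion =
  "nat \<Rightarrow> 'a::real_normed_vector" / partial: completion_rel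
proof (rule part_equivpI)
  show "\<exists>X::nat \<Rightarrow> 'a. completion_rel X X"
    by (rule exI[of _ "\<lambda>_. 0"]) (simp add: completion_rel_def convergent_Cauchy convergent_const)
  show "symp (completion_rel :: (nat \<Rightarrow> 'a) \<Rightarrow> _)"
  proof (rule sympI)
    fix X Y :: "nat \<Rightarrow> 'a" assume *: "completion_rel X Y"
    then have "(\<lambda>n. - (X n - Y n)) \<longlonglongrightarrow> - 0" unfolding completion_rel_def
      by (intro tendsto_minus) auto
    then show "completion_rel Y X" using * by (simp add: completion_rel_def)
  qed
  show "transp (completion_rel :: (nat \<Rightarrow> 'a) \<Rightarrow> _)"
  proof (rule transpI)
    fix X Y Z :: "nat \<Rightarrow> 'a" assume *: "completion_rel X Y" "completion_rel Y Z"
    then have "(\<lambda>n. (X n - Y n) + (Y n - Z n)) \<longlonglongrightarrow> 0 + 0" unfolding completion_rel_def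
      by (intro tendsto_add) auto
    then show "completion_rel X Z" using * by (simp add: completion_rel_def)
  qed
qed

lemma completion_rel_self: "completion_rel X X \<longleftrightarrow> Cauchy X"
  by (simp add: completion_rel_def)

instantiation completion :: (real_normed_vector) real_vector
begin

lift_definition zero_completion :: "'a completion" is "\<lambda>_. 0"
  by (simp add: completion_rel_self convergent_Cauchy convergent_const)

lift_definition plus_completion :: "'a completion \<Rightarrow> 'a completion \<Rightarrow> 'a completion"
  is "\<lambda>X Y n. X n + Y n"
proof -
  fix X X' Y Y' :: "nat \<Rightarrow> 'a" assume *: "completion_rel X X'" "completion_rel Y Y'"
  then have "(\<lambda>n. (X n - X' n) + (Y n - Y' n)) \<longlonglongrightarrow> 0 + 0"
    unfolding completion_rel_def by (intro tendsto_add) auto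
  then show "completion_rel (\<lambda>n. X n + Y n) (\<lambda>n. X' n + Y' n)"
    using * by (auto simp: completion_rel_def algebra_simps intro: Cauchy_add')
qed

lift_definition uminus_completion :: "'a completion \<Rightarrow> 'a completion" is "\<lambda>X n. - X n"
proof -
  fix X X' :: "nat \<Rightarrow> 'a" assume *: "completion_rel X X'"
  then have "(\<lambda>n. - (X n - X' n)) \<longlonglongrightarrow> - 0"
    unfolding completion_rel_def by (intro tendsto_minus) auto
  then show "completion_rel (\<lambda>n. - X n) (\<lambda>n. - X' n)"
    using * by (auto simp: completion_rel_def algebra_simps intro: Cauchy_uminus')
qed

lift_definition minus_completion :: "'a completion \<Rightarrow> 'a completion \<Rightarrow> 'a completion"
  is "\<lambda>X Y n. X n - Y n"
proof -
  fix X X' Y Y' :: "nat \<Rightarrow> 'a" assume *: "completion_rel X X'" "completion_rel Y Y'"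
  then have "(\<lambda>n. (X n - X' n) - (Y n - Y' n)) \<longlonglongrightarrow> 0 - 0"
    unfolding completion_rel_def by (intro tendsto_diff) auto
  then show "completion_rel (\<lambda>n. X n - Y n) (\<lambda>n. X' n - Y' n)"
    using * by (auto simp: completion_rel_def algebra_simps intro: Cauchy_diff')
qed

lift_definition scaleR_completion :: "real \<Rightarrow> 'a completion \<Rightarrow> 'a completion"
  is "\<lambda>r X n. r *\<^sub>R X n"
proof -
  fix r :: real and X X' :: "nat \<Rightarrow> 'a" assume *: "completion_rel X X'"
  then have "(\<lambda>n. r *\<^sub>R (X n - X' n)) \<longlonglongrightarrow> r *\<^sub>R 0"
    unfolding completion_rel_def by (intro tendsto_scaleR tendsto_const) auto
  then show "completion_rel (\<lambda>n. r *\<^sub>R X n) (\<lambda>n. r *\<^sub>R X' n)"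
    using * by (auto simp: completion_rel_def algebra_simps intro: Cauchy_scaleR')
qed

instance
proof
  fix a b c :: "'a completion" and r s :: real
  show "a + b + c = a + (b + c)"
    by transfer (simp add: completion_rel_def Cauchy_add' add.assoc)
  show "a + b = b + a"
    by transfer (simp add: completion_rel_def Cauchy_add' add.commute)
  show "0 + a = a" by transfer (simp add: completion_rel_def)
  show "- a + a = 0"
    by transfer (simp add: completion_rel_def convergent_Cauchy convergent_const)
  show "a - b = a + - b"
    by transfer (simp add: completion_rel_def Cauchy_diff')
  show "r *\<^sub>R (a + b) = r *\<^sub>R a + r *\<^sub>R b"
    by transfer (simp add: completion_rel_def Cauchy_scaleR' Cauchy_add' scaleR_add_right)
  show "(r + s) *\<^sub>R a = r *\<^sub>R a + s *\<^sub>R a"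
    by transfer (simp add: completion_rel_def Cauchy_scaleR' Cauchy_add' scaleR_add_left)
  show "r *\<^sub>R s *\<^sub>R a = (r * s) *\<^sub>R a"
    by transfer (simp add: completion_rel_def Cauchy_scaleR')
  show "1 *\<^sub>R a = a" by transfer (simp add: completion_rel_def)
qed

end

instantiation completion :: (real_normed_vector) real_normed_vector
begin

lift_definition norm_completion :: "'a completion \<Rightarrow> real" is "\<lambda>X. lim (\<lambda>n. norm (X n))"
proof -
  fix X Y :: "nat \<Rightarrow> 'a" assume *: "completion_rel X Y"
  have "(\<lambda>n. norm (X n) - norm (Y n)) \<longlonglongrightarrow> 0"
  proof (rule Lim_null_comparison)
    show "\<forall>\<^sub>F n in sequentially. norm (norm (X n) - norm (Y n)) \<le> norm (X n - Y n)"
      using norm_triangle_ineq3 by (auto intro!: always_eventually)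
    show "(\<lambda>n. norm (X n - Y n)) \<longlonglongrightarrow> 0"
      using * by (simp add: completion_rel_def tendsto_norm_zero)
  qed
  moreover have "(\<lambda>n. norm (Y n)) \<longlonglongrightarrow> lim (\<lambda>n. norm (Y n))"
    using * by (simp add: completion_rel_def Cauchy_convergent_norm convergent_LIMSEQ_iff[symmetric])
  ultimately have "(\<lambda>n. norm (X n) - norm (Y n) + norm (Y n)) \<longlonglongrightarrow> 0 + lim (\<lambda>n. norm (Y n))"
    by (rule tendsto_add)
  then have "(\<lambda>n. norm (X n)) \<longlonglongrightarrow> lim (\<lambda>n. norm (Y n))" by simp
  then show "lim (\<lambda>n. norm (X n)) = lim (\<lambda>n. norm (Y n))" by (rule limI)
qed

definition dist_completion :: "'a completion \<Rightarrow> 'a completion \<Rightarrow> real"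
  where "dist_completion a b = norm (a - b)"

definition sgn_completion :: "'a completion \<Rightarrow> 'a completion"
  where "sgn_completion a = inverse (norm a) *\<^sub>R a"

definition [code del]:
  "(uniformity :: ('a completion \<times> 'a completion) filter) =
    (INF e\<in>{0 <..}. principal {(x, y). dist x y < e})"

definition open_completion :: "'a completion set \<Rightarrow> bool"
  where [code del]:
    "open_completion S = (\<forall>x\<in>S. \<forall>\<^sub>F (x', y) in uniformity. x' = x \<longrightarrow> y \<in> S)"

instance
proof
  fix a b :: "'a completion" and r :: real
  have L: "(\<lambda>n. norm (X n)) \<longlonglongrightarrow> lim (\<lambda>n. norm (X n))" if "Cauchy X" for X :: "nat \<Rightarrow> 'a"
    using that by (simp add: Cauchy_convergent_norm convergent_LIMSEQ_iff[symmetric])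
  show "dist a b = norm (a - b)" by (rule dist_completion_def)
  show "sgn a = a /\<^sub>R norm a" by (rule sgn_completion_def)
  show "uniformity = (INF e\<in>{0<..}. principal {(x, y :: 'a completion). dist x y < e})"
    by (rule uniformity_completion_def)
  show "open U \<longleftrightarrow> (\<forall>x\<in>U. \<forall>\<^sub>F (x', y) in uniformity. x' = x \<longrightarrow> y \<in> U)"
    for U :: "'a completion set" by (rule open_completion_def)
  show "norm a = 0 \<longleftrightarrow> a = 0"
  proof (transfer)
    fix X :: "nat \<Rightarrow> 'a" assume X: "completion_rel X X"
    then have C: "Cauchy X" by (simp add: completion_rel_self)
    have "lim (\<lambda>n. norm (X n)) = 0 \<longleftrightarrow> (\<lambda>n. norm (X n)) \<longlonglongrightarrow> 0"
      using L[OF C] by (metis limI)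
    also have "\<dots> \<longleftrightarrow> X \<longlonglongrightarrow> 0" by (rule tendsto_norm_zero_iff)
    also have "\<dots> \<longleftrightarrow> completion_rel X (\<lambda>_. 0)"
      using C by (simp add: completion_rel_def convergent_Cauchy convergent_const)
    finally show "lim (\<lambda>n. norm (X n)) = 0 \<longleftrightarrow> completion_rel X (\<lambda>_. 0)" .
  qed
  show "norm (a + b) \<le> norm a + norm b"
  proof (transfer)
    fix X Y :: "nat \<Rightarrow> 'a" assume "completion_rel X X" "completion_rel Y Y"
    then have C: "Cauchy X" "Cauchy Y" by (simp_all add: completion_rel_self)
    show "lim (\<lambda>n. norm (X n + Y n)) \<le> lim (\<lambda>n. norm (X n)) + lim (\<lambda>n. norm (Y n))"
      by (rule tendsto_le[OF _ tendsto_add[OF L[OF C(1)] L[OF C(2)]] L[OF Cauchy_add'[OF C]]])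
        (auto intro: always_eventually norm_triangle_ineq)
  qed
  show "norm (r *\<^sub>R a) = \<bar>r\<bar> * norm a"
  proof (transfer)
    fix r :: real and X :: "nat \<Rightarrow> 'a" assume "completion_rel X X"
    then have C: "Cauchy X" by (simp add: completion_rel_self)
    show "lim (\<lambda>n. norm (r *\<^sub>R X n)) = \<bar>r\<bar> * lim (\<lambda>n. norm (X n))"
      using tendsto_mult[OF tendsto_const L[OF C], of "\<bar>r\<bar>"] by (auto intro: limI)
  qed
qed

end

lift_definition to_completion :: "'a::real_normed_vector \<Rightarrow> 'a completion" is "\<lambda>a _. a"
  by (simp add: completion_rel_self convergent_Cauchy convergent_const)

lemma to_completion_add: "to_completion (a + b) = to_completion a + to_completion b"
  by transfer (simp add: completion_rel_self convergent_Cauchy convergent_const)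

lemma to_completion_scaleR: "to_completion (r *\<^sub>R a) = r *\<^sub>R to_completion a"
  by transfer (simp add: completion_rel_self convergent_Cauchy convergent_const)

lemma linear_to_completion: "linear to_completion"
  by (intro linearI to_completion_add to_completion_scaleR)

lemma norm_to_completion [simp]: "norm (to_completion a) = norm a"
  by transfer simp

lemma to_completion_tendsto:
  assumes "Cauchy X"
  shows "(\<lambda>n. to_completion (X n)) \<longlonglongrightarrow> abs_completion X"
proof (rule metric_LIMSEQ_I)
  fix e :: real assume "0 < e"
  then obtain M where M: "\<And>m n. m \<ge> M \<Longrightarrow> n \<ge> M \<Longrightarrow> dist (X m) (X n) < e / 2"
    using metric_CauchyD[OF assms, of "e / 2"] by auto
  show "\<exists>N. \<forall>n\<ge>N. dist (to_completion (X n)) (abs_completion X) < e"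
  proof (intro exI allI impI)
    fix n assume n: "n \<ge> M"
    have C: "Cauchy (\<lambda>m. X n - X m)"
      using assms by (intro Cauchy_diff') (simp_all add: convergent_Cauchy convergent_const)
    have "to_completion (X n) - abs_completion X = abs_completion (\<lambda>m. X n - X m)"
      using assms
      by (simp add: to_completion.abs_eq minus_completion.abs_eq completion_rel_self
          convergent_Cauchy convergent_const)
    then have eq: "norm (to_completion (X n) - abs_completion X) = lim (\<lambda>m. norm (X n - X m))"
      using C by (simp add: norm_completion.abs_eq completion_rel_self)
    have "(\<lambda>m. norm (X n - X m)) \<longlonglongrightarrow> lim (\<lambda>m. norm (X n - X m))"
      using Cauchy_convergent_norm[OF C] by (simp add: convergent_LIMSEQ_iff)
    then have "lim (\<lambda>m. norm (X n - X m)) \<le> e / 2"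
    proof (rule tendsto_upperbound)
      show "\<forall>\<^sub>F m in sequentially. norm (X n - X m) \<le> e / 2"
        using M n by (intro eventually_sequentiallyI[of M]) (auto simp: dist_norm less_imp_le)
    qed simp
    then show "dist (to_completion (X n)) (abs_completion X) < e"
      using eq \<open>0 < e\<close> by (simp add: dist_norm)
  qed
qed

lemma completion_limit:
  obtains X where "Cauchy X" "a = abs_completion X" "(\<lambda>n. to_completion (X n)) \<longlonglongrightarrow> a"
proof -
  have "\<exists>X. Cauchy X \<and> a = abs_completion X"
    by (induction a rule: completion.abs_induct) (auto simp: completion_rel_self)
  then show ?thesis using that to_completion_tendsto by blast
qed

lemma to_completion_dense: "closure (range to_completion) = UNIV"
proof (rule UNIV_eq_I[symmetric])
  fix a :: "'a completion"
  obtain X where "(\<lambda>n. to_completion (X n)) \<longlonglongrightarrow> a" using completion_limit by metis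
  then show "a \<in> closure (range to_completion)" unfolding closure_sequential
    by (intro exI[of _ "\<lambda>n. to_completion (X n)"]) simp
qed

instance completion :: (real_normed_vector) banach
proof
  fix A :: "nat \<Rightarrow> 'a completion" assume A: "Cauchy A"
  have "\<exists>x. dist (to_completion x) (A n) < inverse (real (Suc n))" for n
  proof -
    have "A n \<in> closure (range to_completion)" by (simp add: to_completion_dense)
    then show ?thesis unfolding closure_approachable
      using positive_imp_inverse_positive[of "real (Suc n)"] by fastforce
  qed
  then obtain x where x: "\<And>n. dist (to_completion (x n)) (A n) < inverse (real (Suc n))" by metis
  have iso: "dist (to_completion u) (to_completion v) = dist u v" for u v :: 'a
    by (metis dist_norm linear_diff linear_to_completion norm_to_completion)
  have lim0: "(\<lambda>n. to_completion (x n) - A n) \<longlonglongrightarrow> 0"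
  proof (rule Lim_null_comparison[OF _ LIMSEQ_inverse_real_of_nat])
    show "\<forall>\<^sub>F n in sequentially. norm (to_completion (x n) - A n) \<le> inverse (real (Suc n))"
      using x by (auto simp: dist_norm less_imp_le intro!: always_eventually)
  qed
  then have "Cauchy (\<lambda>n. (to_completion (x n) - A n) + A n)"
    using A by (intro Cauchy_add') (auto intro: LIMSEQ_imp_Cauchy)
  then have "Cauchy x" unfolding Cauchy_def by (simp add: iso)
  then have "(\<lambda>n. to_completion (x n) - (to_completion (x n) - A n)) \<longlonglongrightarrow> abs_completion x - 0"
    using lim0 by (intro tendsto_diff to_completion_tendsto)
  then have "A \<longlonglongrightarrow> abs_completion x" by simp
  then show "convergent A" by (rule convergentI)
qed

lemma bounded_linear_extend_completion:
  fixes T :: "'a::real_normed_vector \<Rightarrow> 'b::banach"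
  assumes "bounded_linear T"
  obtains S :: "'a completion \<Rightarrow>\<^sub>L 'b" where "\<And>a. blinfun_apply S (to_completion a) = T a"
proof -
  interpret T: bounded_linear T by fact
  let ?P = "\<lambda>a X. Cauchy X \<and> (\<lambda>n. to_completion (X n)) \<longlonglongrightarrow> a"
  have ex: "\<exists>X. ?P a X" for a :: "'a completion"
    by (rule completion_limit[of a]) blast
  define R where "R a = (SOME X. ?P a X)" for a :: "'a completion"
  have "?P a (R a)" for a :: "'a completion" unfolding R_def using someI_ex[OF ex[of a]] .
  then have R1: "Cauchy (R a)" and R2: "(\<lambda>n. to_completion (R a n)) \<longlonglongrightarrow> a"
    for a :: "'a completion" by simp_all
  define S where "S a = lim (\<lambda>n. T (R a n))" for a :: "'a completion"
  have S0: "(\<lambda>n. T (R a n)) \<longlonglongrightarrow> S a" for a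
  proof -
    have "convergent (\<lambda>n. T (R a n))" by (rule Cauchy_convergent[OF T.Cauchy[OF R1]])
    then show ?thesis unfolding S_def by (rule convergent_LIMSEQ_iff[THEN iffD1])
  qed
  have S: "(\<lambda>n. T (X n)) \<longlonglongrightarrow> S a" if X: "(\<lambda>n. to_completion (X n)) \<longlonglongrightarrow> a" for a X
  proof -
    have "(\<lambda>n. to_completion (X n) - to_completion (R a n)) \<longlonglongrightarrow> a - a"
      by (intro tendsto_diff X R2)
    then have "(\<lambda>n. norm (to_completion (X n - R a n))) \<longlonglongrightarrow> 0"
      by (simp add: linear_diff[OF linear_to_completion] tendsto_norm_zero)
    then have "(\<lambda>n. X n - R a n) \<longlonglongrightarrow> 0" by (simp add: tendsto_norm_zero_iff)
    then have "(\<lambda>n. T (X n - R a n)) \<longlonglongrightarrow> T 0" by (rule T.tendsto)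
    then have "(\<lambda>n. T (X n - R a n) + T (R a n)) \<longlonglongrightarrow> T 0 + S a"
      by (intro tendsto_add S0)
    then show ?thesis by (simp add: T.diff T.zero)
  qed
  obtain K where K: "\<And>x. norm (T x) \<le> norm x * K" using T.bounded by blast
  have "bounded_linear S"
  proof (rule bounded_linear_intro)
    fix a b :: "'a completion" and r :: real
    have "(\<lambda>n. to_completion (R a n + R b n)) \<longlonglongrightarrow> a + b"
      unfolding to_completion_add by (intro tendsto_add R2)
    from S[OF this] have "(\<lambda>n. T (R a n) + T (R b n)) \<longlonglongrightarrow> S (a + b)" by (simp add: T.add)
    then show "S (a + b) = S a + S b" by (rule LIMSEQ_unique[OF _ tendsto_add[OF S0 S0]])
    have "(\<lambda>n. to_completion (r *\<^sub>R R a n)) \<longlonglongrightarrow> r *\<^sub>R a"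
      unfolding to_completion_scaleR by (intro tendsto_scaleR tendsto_const R2)
    from S[OF this] have "(\<lambda>n. r *\<^sub>R T (R a n)) \<longlonglongrightarrow> S (r *\<^sub>R a)" by (simp add: T.scaleR)
    then show "S (r *\<^sub>R a) = r *\<^sub>R S a"
      by (rule LIMSEQ_unique[OF _ tendsto_scaleR[OF tendsto_const S0]])
    have n1: "(\<lambda>n. norm (T (R a n))) \<longlonglongrightarrow> norm (S a)" by (rule tendsto_norm[OF S0])
    have n2: "(\<lambda>n. norm (to_completion (R a n)) * K) \<longlonglongrightarrow> norm a * K"
      by (intro tendsto_mult tendsto_norm tendsto_const R2)
    show "norm (S a) \<le> norm a * K"
      by (rule LIMSEQ_le[OF n1 n2]) (simp add: K)
  qed
  moreover have "S (to_completion a) = T a" for a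
    using LIMSEQ_unique[OF S[OF tendsto_const] tendsto_const] .
  ultimately show ?thesis
    by (intro that[of "Blinfun S"]) (simp add: bounded_linear_Blinfun_apply)
qed

section \<open>Lipschitz maps and the Lipschitz-free space\<close>

text \<open>The distinguished point is \<open>0\<close>; no algebraic structure comes with it.\<close>

class pointed_metric_space = metric_space + zero

typedef (overloaded) ('x, 'e) lip0 =
  "{f :: 'x::pointed_metric_space \<Rightarrow> 'e::real_normed_vector. f 0 = 0 \<and> (\<exists>L. L-lipschitz_on UNIV f)}"
  morphisms lip0_apply Abs_lip0
  by (rule exI[of _ "\<lambda>_. 0"]) (auto intro!: exI[of _ 0] lipschitz_onI)

setup_lifting type_definition_lip0

lemma lip0_apply_0 [simp]: "lip0_apply f 0 = 0"
  using lip0_apply[of f] by simp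

lemma lip0_lipschitz:
  obtains L where "0 < L" "\<And>x y. norm (lip0_apply f x - lip0_apply f y) \<le> L * dist x y"
proof -
  obtain L where L: "L-lipschitz_on UNIV (lip0_apply f)" using lip0_apply[of f] by auto
  have "norm (lip0_apply f x - lip0_apply f y) \<le> (L + 1) * dist x y" for x y
  proof -
    have "norm (lip0_apply f x - lip0_apply f y) \<le> L * dist x y"
      using lipschitz_onD[OF L, of x y] by (simp add: dist_norm)
    also have "\<dots> \<le> (L + 1) * dist x y" by (simp add: mult_right_mono)
    finally show ?thesis .
  qed
  moreover have "0 < L + 1" using lipschitz_on_nonneg[OF L] by simp
  ultimately show ?thesis using that by blast
qed

definition delta_fun :: "'x::pointed_metric_space \<Rightarrow> 'x \<Rightarrow> ('x, real) lip0 \<Rightarrow> real"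
  where "delta_fun x y = (\<lambda>f. lip0_apply f x - lip0_apply f y)"

typedef (overloaded) 'x molecule =
  "span (range (\<lambda>(x, y). delta_fun (x::'x::pointed_metric_space) y))"
  by (rule exI[of _ 0]) (rule span_zero)

setup_lifting type_definition_molecule

lift_definition delta :: "'x::pointed_metric_space \<Rightarrow> 'x \<Rightarrow> 'x molecule" is delta_fun
  by (rule span_base) auto

instantiation molecule :: (pointed_metric_space) real_vector
begin

lift_definition zero_molecule :: "'a molecule" is 0 by (rule span_zero)
lift_definition plus_molecule :: "'a molecule \<Rightarrow> 'a molecule \<Rightarrow> 'a molecule" is "(+)"
  by (rule span_add)
lift_definition minus_molecule :: "'a molecule \<Rightarrow> 'a molecule \<Rightarrow> 'a molecule" is "(-)"
  by (rule span_diff)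
lift_definition uminus_molecule :: "'a molecule \<Rightarrow> 'a molecule" is uminus
  by (rule span_neg)
lift_definition scaleR_molecule :: "real \<Rightarrow> 'a molecule \<Rightarrow> 'a molecule" is scaleR
  by (rule span_scale)

instance
  by standard (transfer; simp add: algebra_simps)+

end

lemma linear_Rep_molecule: "linear Rep_molecule"
  by (rule linearI) (transfer; simp)+

lemma molecule_eqI:
  assumes "\<And>f. Rep_molecule m f = Rep_molecule m' f" shows "m = m'"
  using assms Rep_molecule_inject by blast

lemma fun_sum_apply: "(\<Sum>i\<in>A. F i) x = (\<Sum>i\<in>A. F i x)" for F :: "'i \<Rightarrow> 'a \<Rightarrow> 'b::comm_monoid_add"
  by (induction A rule: infinite_finite_induct) auto

lemma Rep_molecule_sum:
  "Rep_molecule (\<Sum>i\<in>A. c i *\<^sub>R delta (x i) (y i)) f =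
    (\<Sum>i\<in>A. c i * (lip0_apply f (x i) - lip0_apply f (y i)))"
  by (simp add: linear_sum[OF linear_Rep_molecule] linear_cmul[OF linear_Rep_molecule]
      fun_sum_apply delta.rep_eq delta_fun_def)

lemma molecule_rep:
  obtains n :: nat and c x y where "m = (\<Sum>i<n. c i *\<^sub>R delta (x i) (y i))"
proof -
  have "\<exists>n c x y. F = Rep_molecule (\<Sum>i<(n::nat). c i *\<^sub>R delta (x i) (y i))"
    if "F \<in> span (range (\<lambda>(x, y). delta_fun (x::'a) y))" for F
    using that
  proof (induction rule: span_induct_alt)
    case base
    then show ?case by (intro exI[of _ 0]) (simp add: zero_molecule.rep_eq)
  next
    case (step r d F)
    then obtain n c x y where F: "F = Rep_molecule (\<Sum>i<(n::nat). c i *\<^sub>R delta (x i) (y i))"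
      by blast
    obtain u v where d: "d = Rep_molecule (delta u v)"
      using step by (auto simp: delta.rep_eq)
    have "r *\<^sub>R d + F = Rep_molecule
      (\<Sum>i<Suc n. (c(n := r)) i *\<^sub>R delta ((x(n := u)) i) ((y(n := v)) i))"
      by (simp add: F d plus_molecule.rep_eq scaleR_molecule.rep_eq add.commute)
    then show ?case by blast
  qed
  then obtain n c x y where "Rep_molecule m = Rep_molecule (\<Sum>i<(n::nat). c i *\<^sub>R delta (x i) (y i))"
    using Rep_molecule[of m] by blast
  then show ?thesis using that by (simp add: Rep_molecule_inject)
qed

instantiation molecule :: (pointed_metric_space) real_normed_vector
begin

definition norm_molecule :: "'a molecule \<Rightarrow> real"
  where "norm_molecule m =
    Inf {\<Sum>i<n. \<bar>c i\<bar> * dist (x i) (y i) | (n::nat) c x y. m = (\<Sum>i<n. c i *\<^sub>R delta (x i) (y i))}"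

definition dist_molecule :: "'a molecule \<Rightarrow> 'a molecule \<Rightarrow> real"
  where "dist_molecule a b = norm (a - b)"

definition sgn_molecule :: "'a molecule \<Rightarrow> 'a molecule"
  where "sgn_molecule a = inverse (norm a) *\<^sub>R a"

definition [code del]:
  "(uniformity :: ('a molecule \<times> 'a molecule) filter) =
    (INF e\<in>{0 <..}. principal {(x, y). dist x y < e})"

definition open_molecule :: "'a molecule set \<Rightarrow> bool"
  where [code del]:
    "open_molecule S = (\<forall>x\<in>S. \<forall>\<^sub>F (x', y) in uniformity. x' = x \<longrightarrow> y \<in> S)"

instance
proof
  fix a b :: "'a molecule" and r :: real
  let ?S = "\<lambda>m :: 'a molecule. {\<Sum>i<n. \<bar>c i\<bar> * dist (x i) (y i) | (n::nat) c x y.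
    m = (\<Sum>i<n. c i *\<^sub>R delta (x i) (y i))}"
  have ne: "?S m \<noteq> {}" for m :: "'a molecule" by (rule molecule_rep[of m]) blast
  have bdd: "bdd_below (?S m)" for m :: "'a molecule"
    by (rule bdd_belowI[of _ 0]) (auto intro!: sum_nonneg)
  have upper: "norm m \<le> (\<Sum>i<n. \<bar>c i\<bar> * dist (x i) (y i))"
    if "m = (\<Sum>i<n. c i *\<^sub>R delta (x i) (y i))" for m :: "'a molecule" and n :: nat and c x y
    unfolding norm_molecule_def using that by (intro cInf_lower bdd) blast
  have greatest: "z \<le> norm m"
    if "\<And>n c x y. m = (\<Sum>i<(n::nat). c i *\<^sub>R delta (x i) (y i)) \<Longrightarrow>
      z \<le> (\<Sum>i<n. \<bar>c i\<bar> * dist (x i) (y i))" for m :: "'a molecule" and z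
    unfolding norm_molecule_def using that by (intro cInf_greatest ne) blast
  show "dist a b = norm (a - b)" by (rule dist_molecule_def)
  show "sgn a = a /\<^sub>R norm a" by (rule sgn_molecule_def)
  show "uniformity = (INF e\<in>{0<..}. principal {(x, y :: 'a molecule). dist x y < e})"
    by (rule uniformity_molecule_def)
  show "open U \<longleftrightarrow> (\<forall>x\<in>U. \<forall>\<^sub>F (x', y) in uniformity. x' = x \<longrightarrow> y \<in> U)"
    for U :: "'a molecule set" by (rule open_molecule_def)
  show "norm a = 0 \<longleftrightarrow> a = 0"
  proof
    assume "a = 0"
    then have "norm a \<le> 0" using upper[of a 0] by simp
    moreover have "0 \<le> norm a" by (rule greatest) (auto intro!: sum_nonneg)
    ultimately show "norm a = 0" by simp
  next
    assume 0: "norm a = 0"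
    show "a = 0"
    proof (rule molecule_eqI)
      fix f :: "('a, real) lip0"
      obtain L where L: "0 < L" "\<And>x y. norm (lip0_apply f x - lip0_apply f y) \<le> L * dist x y"
        using lip0_lipschitz by blast
      have "\<bar>Rep_molecule a f\<bar> / L \<le> norm a"
      proof (rule greatest)
        fix n :: nat and c x y assume a: "a = (\<Sum>i<n. c i *\<^sub>R delta (x i) (y i))"
        have "\<bar>Rep_molecule a f\<bar> \<le>
            (\<Sum>i<n. \<bar>c i * (lip0_apply f (x i) - lip0_apply f (y i))\<bar>)"
          unfolding a Rep_molecule_sum by (rule sum_abs)
        also have "\<dots> \<le> (\<Sum>i<n. \<bar>c i\<bar> * (L * dist (x i) (y i)))"
          using L(2) by (intro sum_mono) (simp add: abs_mult mult_left_mono)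
        also have "\<dots> = L * (\<Sum>i<n. \<bar>c i\<bar> * dist (x i) (y i))"
          by (simp add: sum_distrib_left algebra_simps)
        finally show "\<bar>Rep_molecule a f\<bar> / L \<le> (\<Sum>i<n. \<bar>c i\<bar> * dist (x i) (y i))"
          using L(1) by (simp add: field_simps)
      qed
      then have "\<bar>Rep_molecule a f\<bar> \<le> 0" using 0 L(1) by (simp add: field_simps)
      then show "Rep_molecule a f = Rep_molecule 0 f" by (simp add: zero_molecule.rep_eq)
    qed
  qed
  show "norm (a + b) \<le> norm a + norm b"
  proof -
    have "norm (a + b) - norm b \<le> norm a"
    proof (rule greatest)
      fix n :: nat and c x y assume a: "a = (\<Sum>i<n. c i *\<^sub>R delta (x i) (y i))"
      have "norm (a + b) - (\<Sum>i<n. \<bar>c i\<bar> * dist (x i) (y i)) \<le> norm b"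
      proof (rule greatest)
        fix m :: nat and d u v assume b: "b = (\<Sum>i<m. d i *\<^sub>R delta (u i) (v i))"
        let ?c = "\<lambda>i. if i < n then c i else d (i - n)"
        let ?x = "\<lambda>i. if i < n then x i else u (i - n)"
        let ?y = "\<lambda>i. if i < n then y i else v (i - n)"
        have "a + b = (\<Sum>i<n + m. if i < n then c i *\<^sub>R delta (x i) (y i)
            else d (i - n) *\<^sub>R delta (u (i - n)) (v (i - n)))"
          unfolding a b by (rule sum_lessThan_append[symmetric])
        also have "\<dots> = (\<Sum>i<n + m. ?c i *\<^sub>R delta (?x i) (?y i))"
          by (intro sum.cong) auto
        finally have "norm (a + b) \<le> (\<Sum>i<n + m. \<bar>?c i\<bar> * dist (?x i) (?y i))" by (rule upper)
        also have "\<dots> = (\<Sum>i<n + m. if i < n then \<bar>c i\<bar> * dist (x i) (y i)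
            else \<bar>d (i - n)\<bar> * dist (u (i - n)) (v (i - n)))"
          by (intro sum.cong) auto
        also have "\<dots> = (\<Sum>i<n. \<bar>c i\<bar> * dist (x i) (y i)) + (\<Sum>i<m. \<bar>d i\<bar> * dist (u i) (v i))"
          by (rule sum_lessThan_append)
        finally show "norm (a + b) - (\<Sum>i<n. \<bar>c i\<bar> * dist (x i) (y i))
          \<le> (\<Sum>i<m. \<bar>d i\<bar> * dist (u i) (v i))" by simp
      qed
      then show "norm (a + b) - norm b \<le> (\<Sum>i<n. \<bar>c i\<bar> * dist (x i) (y i))" by simp
    qed
    then show ?thesis by simp
  qed
  have le: "norm (s *\<^sub>R m) \<le> \<bar>s\<bar> * norm m" if s: "s \<noteq> 0" for s and m :: "'a molecule"
  proof -
    have "norm (s *\<^sub>R m) / \<bar>s\<bar> \<le> norm m"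
    proof (rule greatest)
      fix n :: nat and c x y assume m: "m = (\<Sum>i<n. c i *\<^sub>R delta (x i) (y i))"
      have "s *\<^sub>R m = (\<Sum>i<n. (s * c i) *\<^sub>R delta (x i) (y i))"
        by (simp add: m scaleR_sum_right)
      then have "norm (s *\<^sub>R m) \<le> (\<Sum>i<n. \<bar>s * c i\<bar> * dist (x i) (y i))" by (rule upper)
      also have "\<dots> = \<bar>s\<bar> * (\<Sum>i<n. \<bar>c i\<bar> * dist (x i) (y i))"
        by (simp add: sum_distrib_left abs_mult algebra_simps)
      finally show "norm (s *\<^sub>R m) / \<bar>s\<bar> \<le> (\<Sum>i<n. \<bar>c i\<bar> * dist (x i) (y i))"
        using s by (simp add: field_simps)
    qed
    then show ?thesis using s by (simp add: field_simps)
  qed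
  show "norm (r *\<^sub>R a) = \<bar>r\<bar> * norm a"
  proof (cases "r = 0")
    case True
    moreover have "norm (0::'a molecule) = 0"
    proof (rule antisym)
      show "norm (0::'a molecule) \<le> 0" using upper[of 0 0] by simp
      show "0 \<le> norm (0::'a molecule)" by (rule greatest) (auto intro!: sum_nonneg)
    qed
    ultimately show ?thesis by simp
  next
    case False
    then have "norm (inverse r *\<^sub>R (r *\<^sub>R a)) \<le> \<bar>inverse r\<bar> * norm (r *\<^sub>R a)" by (intro le) simp
    then have "\<bar>r\<bar> * norm a \<le> norm (r *\<^sub>R a)" using False by (simp add: field_simps)
    then show ?thesis using le[OF False, of a] by simp
  qed
qed

end

lemma norm_molecule_greatest:
  assumes "\<And>n c x y. m = (\<Sum>i<(n::nat). c i *\<^sub>R delta (x i) (y i)) \<Longrightarrow>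
      z \<le> (\<Sum>i<n. \<bar>c i\<bar> * dist (x i) (y i))"
  shows "z \<le> norm m"
proof -
  have "{\<Sum>i<n. \<bar>c i\<bar> * dist (x i) (y i) | (n::nat) c x y.
      m = (\<Sum>i<n. c i *\<^sub>R delta (x i) (y i))} \<noteq> {}" by (rule molecule_rep[of m]) blast
  then show ?thesis unfolding norm_molecule_def using assms by (intro cInf_greatest) blast+
qed

type_synonym 'x lipschitz_free = "'x molecule completion"

definition delta_X :: "'x::pointed_metric_space \<Rightarrow> 'x lipschitz_free"
  where "delta_X x = to_completion (delta x 0)"

text \<open>\<open>linearization_ex1\<close> below shows that this description is proper.\<close>

definition linearization ::
    "('x::pointed_metric_space, 'e::banach) lip0 \<Rightarrow> 'x lipschitz_free \<Rightarrow>\<^sub>L 'e"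
  where "linearization T = (THE S. blinfun_apply S \<circ> delta_X = lip0_apply T)"

lemma delta_eq_diff: "delta x y = delta x 0 - delta y 0"
  by (rule molecule_eqI) (simp add: minus_molecule.rep_eq delta.rep_eq delta_fun_def)

lemma lip0_bump:
  fixes x :: "'x::pointed_metric_space"
  assumes "finite F" "x \<notin> F" "0 \<in> F"
  obtains f :: "('x, real) lip0" where "lip0_apply f x \<noteq> 0" "\<And>y. y \<in> F \<Longrightarrow> lip0_apply f y = 0"
proof -
  define r where "r = Min ((\<lambda>y. dist y x) ` F)"
  have r: "r \<le> dist y x" if "y \<in> F" for y unfolding r_def using assms that by auto
  have "r \<in> (\<lambda>y. dist y x) ` F" unfolding r_def using assms by (intro Min_in) auto
  then have "0 < r" using assms by auto
  define g where "g y = max 0 (r - dist y x)" for y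
  have "1-lipschitz_on UNIV g"
  proof (rule lipschitz_onI)
    fix u v :: 'x
    have "\<bar>dist u x - dist v x\<bar> \<le> dist u v"
      using dist_triangle[of u x v] dist_triangle[of v x u] by (simp add: dist_commute)
    then show "dist (g u) (g v) \<le> 1 * dist u v" by (auto simp: g_def dist_real_def)
  qed simp
  moreover have g0: "g y = 0" if "y \<in> F" for y using r[OF that] by (simp add: g_def)
  ultimately have "g \<in> {f. f 0 = 0 \<and> (\<exists>L. L-lipschitz_on UNIV f)}" using assms(3) by blast
  then have "lip0_apply (Abs_lip0 g) = g" by (rule Abs_lip0_inverse)
  moreover have "g x \<noteq> 0" using \<open>0 < r\<close> by (simp add: g_def)
  ultimately show ?thesis by (intro that[of "Abs_lip0 g"]) (simp_all only: g0 not_False_eq_True)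
qed

lemma delta_0_independent:
  fixes P :: "'x::pointed_metric_space set"
  shows "inj_on (\<lambda>x::'x. delta x 0) UNIV"
    and "independent ((\<lambda>x::'x. delta x 0) ` (- {0}))"
proof -
  have Rep: "Rep_molecule (delta x 0) f = lip0_apply f x" for x :: 'x and f
    by (simp add: delta.rep_eq delta_fun_def)
  show inj: "inj_on (\<lambda>x::'x. delta x 0) UNIV"
  proof (rule injI, rule ccontr)
    fix x y :: 'x assume eq: "delta x 0 = delta y 0" and "x \<noteq> y"
    have *: "lip0_apply f x = lip0_apply f y" for f :: "('x, real) lip0" using eq Rep by metis
    show False
    proof (cases "x = 0")
      case True
      with \<open>x \<noteq> y\<close> obtain f :: "('x, real) lip0" where "lip0_apply f y \<noteq> 0"
        using lip0_bump[of "{0}" y] by auto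
      then show False using *[of f] True by simp
    next
      case False
      with \<open>x \<noteq> y\<close> obtain f :: "('x, real) lip0" where "lip0_apply f x \<noteq> 0" "lip0_apply f y = 0"
        using lip0_bump[of "{0, y}" x] by auto
      then show False using *[of f] by simp
    qed
  qed
  show "independent ((\<lambda>x::'x. delta x 0) ` (- {0}))"
    unfolding independent_explicit_finite_subsets
  proof (intro allI impI ballI)
    fix S :: "'x molecule set" and c v
    assume S: "S \<subseteq> (\<lambda>x. delta x 0) ` (- {0})" "finite S" and 0: "(\<Sum>v\<in>S. c v *\<^sub>R v) = 0"
      and v: "v \<in> S"
    obtain P where P: "P \<subseteq> - {0}" "finite P" "S = (\<lambda>x. delta x 0) ` P"
      using finite_subset_image[OF S(2,1)] by auto
    then obtain x where x: "x \<in> P" "v = delta x 0" using v by auto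
    obtain f :: "('x, real) lip0"
      where f: "lip0_apply f x \<noteq> 0" "\<And>y. y \<in> insert 0 (P - {x}) \<Longrightarrow> lip0_apply f y = 0"
      using lip0_bump[of "insert 0 (P - {x})" x] P x by auto
    have inj': "inj_on (\<lambda>x::'x. delta x 0) P" using inj by (rule inj_on_subset) simp
    have "0 = Rep_molecule (\<Sum>v\<in>S. c v *\<^sub>R v) f" by (simp add: 0 zero_molecule.rep_eq)
    also have "\<dots> = (\<Sum>v\<in>S. c v * Rep_molecule v f)"
      by (simp add: linear_sum[OF linear_Rep_molecule] linear_cmul[OF linear_Rep_molecule]
          fun_sum_apply)
    also have "\<dots> = (\<Sum>y\<in>P. c (delta y 0) * lip0_apply f y)"
      unfolding P(3) sum.reindex[OF inj'] by (simp add: Rep)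
    also have "\<dots> = (\<Sum>y\<in>{x}. c (delta y 0) * lip0_apply f y)"
      using P(2) x(1) f(2) by (intro sum.mono_neutral_right) auto
    finally show "c v = 0" using f(1) x(2) by simp
  qed
qed

lemma linearization_ex1:
  fixes T :: "('x::pointed_metric_space, 'e::banach) lip0"
  shows "\<exists>!S. blinfun_apply S \<circ> delta_X = lip0_apply T"
proof (rule ex_ex1I)
  let ?inv = "inv (\<lambda>x::'x. delta x 0)"
  obtain g :: "'x molecule \<Rightarrow> 'e" where g: "linear g"
    and "\<forall>m \<in> (\<lambda>x. delta x 0) ` (- {0}). g m = lip0_apply T (?inv m)"
    using linear_independent_extend[OF delta_0_independent(2), of "\<lambda>m. lip0_apply T (?inv m)"]
    by auto
  then have "g (delta x 0) = lip0_apply T x" if "x \<noteq> 0" for x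
    using that by (simp add: inv_f_f[OF delta_0_independent(1)])
  moreover have "delta 0 0 = (0 :: 'x molecule)"
    by (rule molecule_eqI) (simp add: zero_molecule.rep_eq delta.rep_eq delta_fun_def)
  ultimately have g0: "g (delta x 0) = lip0_apply T x" for x
    by (cases "x = 0") (auto simp: linear_0[OF g])
  have gd: "g (delta x y) = lip0_apply T x - lip0_apply T y" for x y
    by (subst delta_eq_diff) (simp add: linear_diff[OF g] g0)
  obtain L where L: "0 < L" "\<And>x y. norm (lip0_apply T x - lip0_apply T y) \<le> L * dist x y"
    using lip0_lipschitz by blast
  have "norm (g m) / L \<le> norm m" for m
  proof (rule norm_molecule_greatest)
    fix n :: nat and c x y assume m: "m = (\<Sum>i<n. c i *\<^sub>R delta (x i) (y i))"
    have "norm (g m) \<le> (\<Sum>i<n. norm (c i *\<^sub>R (lip0_apply T (x i) - lip0_apply T (y i))))"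
      unfolding m linear_sum[OF g] linear_cmul[OF g] gd by (rule norm_sum)
    also have "\<dots> \<le> (\<Sum>i<n. \<bar>c i\<bar> * (L * dist (x i) (y i)))"
      unfolding norm_scaleR using L(2) by (intro sum_mono mult_left_mono) auto
    also have "\<dots> = L * (\<Sum>i<n. \<bar>c i\<bar> * dist (x i) (y i))"
      by (simp add: sum_distrib_left algebra_simps)
    finally show "norm (g m) / L \<le> (\<Sum>i<n. \<bar>c i\<bar> * dist (x i) (y i))"
      using L(1) by (simp add: field_simps)
  qed
  then have "norm (g m) \<le> norm m * L" for m using L(1) by (simp add: field_simps)
  then have "bounded_linear g"
    using g by (intro bounded_linear_intro) (auto simp: linear_add linear_cmul)
  then obtain S :: "'x lipschitz_free \<Rightarrow>\<^sub>L 'e" where "\<And>m. blinfun_apply S (to_completion m) = g m"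
    using bounded_linear_extend_completion by blast
  then show "\<exists>S. blinfun_apply S \<circ> delta_X = lip0_apply T"
    by (intro exI[of _ S]) (simp add: fun_eq_iff delta_X_def g0)
next
  fix S S' :: "'x lipschitz_free \<Rightarrow>\<^sub>L 'e"
  assume "blinfun_apply S \<circ> delta_X = lip0_apply T" "blinfun_apply S' \<circ> delta_X = lip0_apply T"
  then have eq: "S (to_completion (delta x 0)) = S' (to_completion (delta x 0))" for x
    by (metis comp_apply delta_X_def)
  have lin: "linear to_completion" by (rule linear_to_completion)
  have eq': "S (to_completion (delta x y)) = S' (to_completion (delta x y))" for x y
    by (subst (1 2) delta_eq_diff) (simp add: linear_diff[OF lin] blinfun.diff_right eq)
  have eqm: "S (to_completion m) = S' (to_completion m)" for m
  proof -
    obtain n :: nat and c x y where m: "m = (\<Sum>i<n. c i *\<^sub>R delta (x i) (y i))"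
      by (rule molecule_rep)
    show ?thesis unfolding m linear_sum[OF lin] linear_cmul[OF lin]
      by (simp add: blinfun.sum_right blinfun.scaleR_right eq')
  qed
  show "S = S'"
  proof (rule blinfun_eqI)
    fix a :: "'x lipschitz_free"
    obtain X where X: "(\<lambda>n. to_completion (X n)) \<longlonglongrightarrow> a" using completion_limit by metis
    have "(\<lambda>n. S (to_completion (X n))) \<longlonglongrightarrow> S a"
      by (intro bounded_linear.tendsto[OF blinfun.bounded_linear_right] X)
    moreover have "(\<lambda>n. S (to_completion (X n))) \<longlonglongrightarrow> S' a"
      unfolding eqm by (intro bounded_linear.tendsto[OF blinfun.bounded_linear_right] X)
    ultimately show "S a = S' a" by (rule LIMSEQ_unique)
  qed
qed

lemma linearization_apply: "linearization T (delta_X x) = lip0_apply T x"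
  using theI'[OF linearization_ex1, of T] unfolding linearization_def by (metis comp_apply)

section \<open>Algebraic tensor products\<close>

text \<open>
  The elementary tensor of \<open>x\<close> and \<open>y\<close> is the evaluation functional \<open>A \<mapsto> A x y\<close> on the space of
  bilinear forms, and the tensor product is the linear span of these.  \<open>tensor_universal\<close> below is
  the universal property.
\<close>

definition tensor_fun ::
    "'f::real_vector \<Rightarrow> 'g::real_vector \<Rightarrow> ('f \<Rightarrow> 'g \<Rightarrow> real) \<Rightarrow> real"
  where "tensor_fun x y = (\<lambda>A. if bilinear A then A x y else 0)"

typedef (overloaded) ('f, 'g) tensor =
  "span (range (\<lambda>(x::'f::real_vector, y::'g::real_vector). tensor_fun x y))"
  by (rule exI[of _ 0]) (rule span_zero)

setup_lifting type_definition_tensor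

lift_definition tensor_elem :: "'f::real_vector \<Rightarrow> 'g::real_vector \<Rightarrow> ('f, 'g) tensor"
    (infixl "\<otimes>\<^sub>T" 75) is tensor_fun
  by (rule span_base) auto

instantiation tensor :: (real_vector, real_vector) real_vector
begin

lift_definition zero_tensor :: "('a, 'b) tensor" is 0 by (rule span_zero)
lift_definition plus_tensor :: "('a, 'b) tensor \<Rightarrow> ('a, 'b) tensor \<Rightarrow> ('a, 'b) tensor" is "(+)"
  by (rule span_add)
lift_definition minus_tensor :: "('a, 'b) tensor \<Rightarrow> ('a, 'b) tensor \<Rightarrow> ('a, 'b) tensor" is "(-)"
  by (rule span_diff)
lift_definition uminus_tensor :: "('a, 'b) tensor \<Rightarrow> ('a, 'b) tensor" is uminus
  by (rule span_neg)
lift_definition scaleR_tensor :: "real \<Rightarrow> ('a, 'b) tensor \<Rightarrow> ('a, 'b) tensor" is scaleR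
  by (rule span_scale)

instance
  by standard (transfer; simp add: algebra_simps)+

end

lemma linear_Rep_tensor: "linear Rep_tensor"
  by (rule linearI) (transfer; simp)+

lemma Rep_tensor_sum:
  "Rep_tensor (\<Sum>i\<in>I. x i \<otimes>\<^sub>T y i) A = (if bilinear A then \<Sum>i\<in>I. A (x i) (y i) else 0)"
  by (simp add: linear_sum[OF linear_Rep_tensor] fun_sum_apply tensor_elem.rep_eq tensor_fun_def)

lemma tensor_sum_eq_iff:
  fixes x :: "'i \<Rightarrow> 'f::real_vector" and y :: "'i \<Rightarrow> 'g::real_vector"
  shows "(\<Sum>i\<in>I. x i \<otimes>\<^sub>T y i) = (\<Sum>j\<in>J. x' j \<otimes>\<^sub>T y' j) \<longleftrightarrow>
    (\<forall>A :: 'f \<Rightarrow> 'g \<Rightarrow> real. bilinear A \<longrightarrow>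
      (\<Sum>i\<in>I. A (x i) (y i)) = (\<Sum>j\<in>J. A (x' j) (y' j)))"
  unfolding Rep_tensor_inject[symmetric] fun_eq_iff Rep_tensor_sum by auto

lemma tensor_eqI:
  fixes u v :: "('a::real_vector, 'b::real_vector) tensor"
  assumes "\<And>A. bilinear A \<Longrightarrow> Rep_tensor u A = Rep_tensor v A"
  shows "u = v"
proof -
  have F: "F A = 0" if "F \<in> span (range (\<lambda>(x::'a, y::'b). tensor_fun x y))" "\<not> bilinear A" for F A
    using that(1) by (induction rule: span_induct_alt) (auto simp: tensor_fun_def that(2))
  have "Rep_tensor w A = 0" if "\<not> bilinear A" for w :: "('a, 'b) tensor" and A
    by (rule F[OF Rep_tensor that])
  then have "Rep_tensor u = Rep_tensor v" using assms by (intro ext) metis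
  then show ?thesis by (simp add: Rep_tensor_inject)
qed

lemma tensor_elem_linear:
  shows "linear (\<lambda>x. x \<otimes>\<^sub>T y)" "linear (\<lambda>y. x \<otimes>\<^sub>T y)"
  by (auto intro!: linearI tensor_eqI
      simp: tensor_elem.rep_eq plus_tensor.rep_eq scaleR_tensor.rep_eq tensor_fun_def
        bilinear_ladd bilinear_lmul bilinear_radd bilinear_rmul)

lemma tensor_rep:
  fixes u :: "('a::real_vector, 'b::real_vector) tensor"
  obtains n :: nat and x y where "u = (\<Sum>i<n. x i \<otimes>\<^sub>T y i)"
proof -
  have "\<exists>n x y. F = Rep_tensor (\<Sum>i<(n::nat). x i \<otimes>\<^sub>T y i)"
    if "F \<in> span (range (\<lambda>(x::'a, y::'b). tensor_fun x y))" for F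
    using that
  proof (induction rule: span_induct_alt)
    case base
    then show ?case by (intro exI[of _ 0]) (simp add: zero_tensor.rep_eq)
  next
    case (step r d F)
    then obtain n x y where F: "F = Rep_tensor (\<Sum>i<(n::nat). x i \<otimes>\<^sub>T y i)"
      by blast
    obtain v w where d: "d = Rep_tensor (v \<otimes>\<^sub>T w)"
      using step by (auto simp: tensor_elem.rep_eq)
    have "r *\<^sub>R d = Rep_tensor ((r *\<^sub>R v) \<otimes>\<^sub>T w)"
      by (simp add: d linear_cmul[OF tensor_elem_linear(1)] scaleR_tensor.rep_eq)
    then have "r *\<^sub>R d + F = Rep_tensor
      (\<Sum>i<Suc n. (x(n := r *\<^sub>R v)) i \<otimes>\<^sub>T (y(n := w)) i)"
      by (simp add: F plus_tensor.rep_eq add.commute)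
    then show ?case by blast
  qed
  then obtain n x y where "Rep_tensor u = Rep_tensor (\<Sum>i<(n::nat). x i \<otimes>\<^sub>T y i)"
    using Rep_tensor[of u] by blast
  then show ?thesis using that by (simp add: Rep_tensor_inject)
qed

lemma basis_exists:
  obtains B :: "'a::real_vector set" where "independent B" "span B = UNIV"
  using independent_extend_basis[OF independent_empty] span_extend_basis[OF independent_empty]
  by blast

lemma tensor_universal:
  fixes B :: "'f::real_vector \<Rightarrow> 'g::real_vector \<Rightarrow> 'h::real_vector"
  assumes B: "bilinear B"
  shows "\<exists>!L. linear L \<and> (\<forall>x y. L (x \<otimes>\<^sub>T y) = B x y)"
proof (rule ex_ex1I)
  let ?P = "\<lambda>u n x y. u = (\<Sum>i<(n::nat). x i \<otimes>\<^sub>T y i)"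
  have wd: "(\<Sum>i<n. B (x i) (y i)) = (\<Sum>i<m. B (x' i) (y' i))"
    if "?P u n x y" "?P u m x' y'" for u n m x y x' y'
  proof -
    obtain H :: "'h set" where H: "independent H" "span H = UNIV" by (rule basis_exists)
    have lin: "linear (\<lambda>v. representation H v b)" for b
      using H by (intro linearI) (auto simp: representation_add representation_scale)
    have "representation H (\<Sum>i<n. B (x i) (y i)) b = representation H (\<Sum>i<m. B (x' i) (y' i)) b"
      for b
    proof -
      have "bilinear (\<lambda>x y. representation H (B x y) b)"
        using B unfolding bilinear_def by (auto intro: linear_compose[OF _ lin, unfolded o_def])
      moreover have "(\<Sum>i<n. x i \<otimes>\<^sub>T y i) = (\<Sum>i<m. x' i \<otimes>\<^sub>T y' i)" using that by simp
      ultimately have "(\<Sum>i<n. representation H (B (x i) (y i)) b) =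
          (\<Sum>i<m. representation H (B (x' i) (y' i)) b)"
        unfolding tensor_sum_eq_iff by blast
      then show ?thesis unfolding linear_sum[OF lin] .
    qed
    then show ?thesis
      using sum_nonzero_representation_eq[OF H(1)] H(2) by (metis (no_types, lifting) UNIV_I ext)
  qed
  define L where "L u = (SOME h. \<exists>n x y. ?P u n x y \<and> h = (\<Sum>i<n. B (x i) (y i)))" for u
  have L: "L u = (\<Sum>i<n. B (x i) (y i))" if u: "?P u n x y" for u n x y
    unfolding L_def
  proof (rule some_equality)
    show "\<exists>n' x' y'. ?P u n' x' y' \<and> (\<Sum>i<n. B (x i) (y i)) = (\<Sum>i<n'. B (x' i) (y' i))"
      using u by blast
    show "h = (\<Sum>i<n. B (x i) (y i))" if "\<exists>n x y. ?P u n x y \<and> h = (\<Sum>i<n. B (x i) (y i))" for h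
      using that wd[OF _ u] by blast
  qed
  have "linear L"
  proof (rule linearI)
    fix u v :: "('f, 'g) tensor" and r :: real
    obtain n x y where u: "?P u n x y" by (rule tensor_rep)
    obtain m x' y' where v: "?P v m x' y'" by (rule tensor_rep)
    let ?x = "\<lambda>i. if i < n then x i else x' (i - n)" and ?y = "\<lambda>i. if i < n then y i else y' (i - n)"
    have *: "(\<Sum>i<n + m. F (?x i) (?y i)) = (\<Sum>i<n. F (x i) (y i)) + (\<Sum>i<m. F (x' i) (y' i))"
      for F :: "'f \<Rightarrow> 'g \<Rightarrow> 'z::comm_monoid_add"
      by (subst sum_lessThan_append[symmetric]) (auto intro!: sum.cong)
    have "?P (u + v) (n + m) ?x ?y" unfolding * u v ..
    from L[OF this] show "L (u + v) = L u + L v" unfolding * L[OF u] L[OF v] .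
    have "?P (r *\<^sub>R u) n (\<lambda>i. r *\<^sub>R x i) y"
      by (simp add: u scaleR_sum_right linear_cmul[OF tensor_elem_linear(1)])
    from L[OF this] show "L (r *\<^sub>R u) = r *\<^sub>R L u"
      unfolding L[OF u] by (simp add: bilinear_lmul[OF B] scaleR_sum_right)
  qed
  moreover have "L (x \<otimes>\<^sub>T y) = B x y" for x y
  proof -
    have "?P (x \<otimes>\<^sub>T y) 1 (\<lambda>_. x) (\<lambda>_. y)" by simp
    from L[OF this] show ?thesis by simp
  qed
  ultimately show "\<exists>L. linear L \<and> (\<forall>x y. L (x \<otimes>\<^sub>T y) = B x y)" by blast
next
  fix L L' :: "('f, 'g) tensor \<Rightarrow> 'h"
  assume L: "linear L \<and> (\<forall>x y. L (x \<otimes>\<^sub>T y) = B x y)"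
    and L': "linear L' \<and> (\<forall>x y. L' (x \<otimes>\<^sub>T y) = B x y)"
  show "L = L'"
  proof
    fix u :: "('f, 'g) tensor"
    obtain n :: nat and x y where "u = (\<Sum>i<n. x i \<otimes>\<^sub>T y i)" by (rule tensor_rep)
    then show "L u = L' u" using L L' by (simp add: linear_sum)
  qed
qed

section \<open>The norm \<open>d\<^sub>p\<close> and \<open>p\<close>-summing operators\<close>

text \<open>Extended-real arithmetic gives \<open>1 / \<infinity> = 0\<close> and \<open>1 / 0 = \<infinity>\<close>.\<close>

definition conj_exp :: "ereal \<Rightarrow> ereal"
  where "conj_exp p = 1 / (1 - 1 / p)"

lemma conj_exp_simps:
  "conj_exp 1 = \<infinity>" "conj_exp \<infinity> = 1"
  "1 < r \<Longrightarrow> conj_exp (ereal r) = ereal (r / (r - 1))"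
proof -
  show "conj_exp 1 = \<infinity>" "conj_exp \<infinity> = 1"
    by (simp_all add: conj_exp_def one_ereal_def divide_ereal_def)
  assume "1 < r"
  then have "1 / (1 - 1 / ereal r) = ereal (1 / (1 - 1 / r))"
    by (simp add: one_ereal_def)
  then show "conj_exp (ereal r) = ereal (r / (r - 1))"
    using \<open>1 < r\<close> by (simp add: conj_exp_def field_simps)
qed

text \<open>Inserting \<open>0\<close> makes the maximum of the empty sequence \<open>0\<close> and changes nothing otherwise.\<close>

definition lp_norm :: "ereal \<Rightarrow> nat \<Rightarrow> (nat \<Rightarrow> 'f::real_normed_vector) \<Rightarrow> real"
  where "lp_norm p n x =
    (if p = \<infinity> then Max (insert 0 ((\<lambda>i. norm (x i)) ` {..<n}))
     else (\<Sum>i<n. norm (x i) powr real_of_ereal p) powr (1 / real_of_ereal p))"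

definition weak_lp_norm :: "ereal \<Rightarrow> nat \<Rightarrow> (nat \<Rightarrow> 'f::real_normed_vector) \<Rightarrow> real"
  where "weak_lp_norm p n x =
    (SUP \<phi> \<in> {\<phi> :: 'f \<Rightarrow>\<^sub>L real. norm \<phi> \<le> 1}. lp_norm p n (\<lambda>i. blinfun_apply \<phi> (x i)))"

definition dp :: "ereal \<Rightarrow> ('f::real_normed_vector, 'g::real_normed_vector) tensor \<Rightarrow> real"
  where "dp p u =
    Inf {weak_lp_norm p n x * lp_norm (conj_exp p) n g | n x g. u = (\<Sum>i<n. x i \<otimes>\<^sub>T g i)}"

definition p_summing :: "ereal \<Rightarrow> ('f::banach \<Rightarrow> 'g::banach) \<Rightarrow> bool"
  where "p_summing p S \<longleftrightarrow> linear S \<and>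
    (\<exists>C>0. \<forall>(n::nat) (x :: nat \<Rightarrow> 'f) (g :: nat \<Rightarrow> 'g \<Rightarrow>\<^sub>L real).
      \<bar>\<Sum>i<n. blinfun_apply (g i) (S (x i))\<bar> \<le> C * dp p (\<Sum>i<n. x i \<otimes>\<^sub>T g i))"

section \<open>Strictly Lipschitz \<open>p\<close>-summing maps\<close>

definition box_fun :: "'x::pointed_metric_space \<Rightarrow> 'x \<Rightarrow> ('e::real_normed_vector \<Rightarrow>\<^sub>L real) \<Rightarrow>
    ('x, ('e \<Rightarrow>\<^sub>L real) \<Rightarrow>\<^sub>L real) lip0 \<Rightarrow> real"
  where "box_fun x y e = (\<lambda>f. blinfun_apply (lip0_apply f x - lip0_apply f y) e)"

text \<open>The type \<open>('x, 'e) box\<close> is the space \<open>X \<boxtimes> E\<^sup>*\<close>: its second parameter is \<open>E\<close>, not the dual.\<close>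

typedef (overloaded) ('x, 'e) box =
  "span (range (\<lambda>(x::'x::pointed_metric_space, y, e::'e::real_normed_vector \<Rightarrow>\<^sub>L real). box_fun x y e))"
  by (rule exI[of _ 0]) (rule span_zero)

setup_lifting type_definition_box

lift_definition box_elem :: "'x::pointed_metric_space \<Rightarrow> 'x \<Rightarrow> ('e::real_normed_vector \<Rightarrow>\<^sub>L real) \<Rightarrow>
    ('x, 'e) box" is box_fun
proof -
  fix x y :: 'x and e :: "'e \<Rightarrow>\<^sub>L real"
  have "box_fun x y e = (case (x, y, e) of (x, y, e) \<Rightarrow> box_fun x y e)" by simp
  then show "box_fun x y e \<in> span (range (\<lambda>(x, y, e). box_fun x y e))"
    by (intro span_base) (rule range_eqI)
qed

instantiation box :: (pointed_metric_space, real_normed_vector) real_vector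
begin

lift_definition zero_box :: "('a, 'b) box" is 0 by (rule span_zero)
lift_definition plus_box :: "('a, 'b) box \<Rightarrow> ('a, 'b) box \<Rightarrow> ('a, 'b) box" is "(+)"
  by (rule span_add)
lift_definition minus_box :: "('a, 'b) box \<Rightarrow> ('a, 'b) box \<Rightarrow> ('a, 'b) box" is "(-)"
  by (rule span_diff)
lift_definition uminus_box :: "('a, 'b) box \<Rightarrow> ('a, 'b) box" is uminus
  by (rule span_neg)
lift_definition scaleR_box :: "real \<Rightarrow> ('a, 'b) box \<Rightarrow> ('a, 'b) box" is scaleR
  by (rule span_scale)

instance
  by standard (transfer; simp add: algebra_simps)+

end

lemma linear_Rep_box: "linear Rep_box"
  by (rule linearI) (transfer; simp)+

lemma Rep_box_sum:
  "Rep_box (\<Sum>i\<in>I. box_elem (x i) (y i) (e i)) f =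
    (\<Sum>i\<in>I. blinfun_apply (lip0_apply f (x i) - lip0_apply f (y i)) (e i))"
  by (simp add: linear_sum[OF linear_Rep_box] fun_sum_apply box_elem.rep_eq box_fun_def)

text \<open>\<open>box_to_tensor\<close> is the map \<open>\<Phi>\<close>; \<open>box_to_tensor_sum\<close> below shows that it does not depend on
  the representation.\<close>

definition box_to_tensor :: "('x::pointed_metric_space, 'e::real_normed_vector) box \<Rightarrow>
    ('x lipschitz_free, 'e \<Rightarrow>\<^sub>L real) tensor"
  where "box_to_tensor u = (THE v. \<exists>(n::nat) x y e. u = (\<Sum>i<n. box_elem (x i) (y i) (e i)) \<and>
    v = (\<Sum>i<n. to_completion (delta (x i) (y i)) \<otimes>\<^sub>T e i))"

lemma box_eq_imp_tensor_eq:
  fixes e e' :: "nat \<Rightarrow> 'e::real_normed_vector \<Rightarrow>\<^sub>L real"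
    and x y x' y' :: "nat \<Rightarrow> 'x::pointed_metric_space"
  assumes eq: "(\<Sum>i<n. box_elem (x i) (y i) (e i)) = (\<Sum>i<m. box_elem (x' i) (y' i) (e' i))"
  shows "(\<Sum>i<n. to_completion (delta (x i) (y i)) \<otimes>\<^sub>T e i) =
    (\<Sum>i<m. to_completion (delta (x' i) (y' i)) \<otimes>\<^sub>T e' i)"
proof -
  have 1: "(\<Sum>i<n. (lip0_apply g (x i) - lip0_apply g (y i)) *\<^sub>R e i) =
    (\<Sum>i<m. (lip0_apply g (x' i) - lip0_apply g (y' i)) *\<^sub>R e' i)" for g :: "('x, real) lip0"
  proof (rule blinfun_eqI)
    fix z :: 'e
    define ev where "ev = Blinfun (\<lambda>b :: 'e \<Rightarrow>\<^sub>L real. blinfun_apply b z)"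
    have ev: "blinfun_apply ev b = blinfun_apply b z" for b
      unfolding ev_def by (simp add: bounded_linear_Blinfun_apply blinfun.bounded_linear_left)
    obtain L where L: "0 < L" "\<And>x y. norm (lip0_apply g x - lip0_apply g y) \<le> L * dist x y"
      using lip0_lipschitz by blast
    have "(L * norm ev)-lipschitz_on UNIV (\<lambda>x. lip0_apply g x *\<^sub>R ev)"
    proof (rule lipschitz_onI)
      fix x y
      have "dist (lip0_apply g x *\<^sub>R ev) (lip0_apply g y *\<^sub>R ev) =
          norm (lip0_apply g x - lip0_apply g y) * norm ev"
        by (simp add: dist_norm scaleR_diff_left[symmetric])
      also have "\<dots> \<le> L * dist x y * norm ev" using L(2) by (intro mult_right_mono) auto
      finally show "dist (lip0_apply g x *\<^sub>R ev) (lip0_apply g y *\<^sub>R ev) \<le> L * norm ev * dist x y"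
        by (simp add: algebra_simps)
    qed (use L(1) in simp)
    then have f: "lip0_apply (Abs_lip0 (\<lambda>x. lip0_apply g x *\<^sub>R ev)) = (\<lambda>x. lip0_apply g x *\<^sub>R ev)"
      by (intro Abs_lip0_inverse) auto
    have "Rep_box (\<Sum>i<n. box_elem (x i) (y i) (e i)) (Abs_lip0 (\<lambda>x. lip0_apply g x *\<^sub>R ev)) =
      Rep_box (\<Sum>i<m. box_elem (x' i) (y' i) (e' i)) (Abs_lip0 (\<lambda>x. lip0_apply g x *\<^sub>R ev))"
      by (simp only: eq)
    then show "blinfun_apply (\<Sum>i<n. (lip0_apply g (x i) - lip0_apply g (y i)) *\<^sub>R e i) z =
      blinfun_apply (\<Sum>i<m. (lip0_apply g (x' i) - lip0_apply g (y' i)) *\<^sub>R e' i) z"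
      unfolding Rep_box_sum f scaleR_diff_left[symmetric]
      by (simp add: blinfun.sum_left blinfun.scaleR_left ev)
  qed
  obtain H :: "('e \<Rightarrow>\<^sub>L real) set" where H: "independent H" "span H = UNIV" by (rule basis_exists)
  have lin: "linear (\<lambda>v. representation H v b)" for b
    using H by (intro linearI) (auto simp: representation_add representation_scale)
  have 2: "(\<Sum>i<n. representation H (e i) b *\<^sub>R delta (x i) (y i)) =
    (\<Sum>i<m. representation H (e' i) b *\<^sub>R delta (x' i) (y' i))" for b
  proof (rule molecule_eqI)
    fix g :: "('x, real) lip0"
    show "Rep_molecule (\<Sum>i<n. representation H (e i) b *\<^sub>R delta (x i) (y i)) g =
      Rep_molecule (\<Sum>i<m. representation H (e' i) b *\<^sub>R delta (x' i) (y' i)) g"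
      using arg_cong[OF 1[of g], of "\<lambda>v. representation H v b"]
      unfolding Rep_molecule_sum by (simp add: linear_sum[OF lin] linear_cmul[OF lin] mult.commute)
  qed
  define K where "K = (\<Union>i<n. {b. representation H (e i) b \<noteq> 0}) \<union>
    (\<Union>i<m. {b. representation H (e' i) b \<noteq> 0})"
  have K: "finite K" unfolding K_def by (auto simp: finite_representation)
  have rep: "v = (\<Sum>b\<in>K. representation H v b *\<^sub>R b)"
    if "{b. representation H v b \<noteq> 0} \<subseteq> K" for v
  proof -
    have "v = (\<Sum>b | representation H v b \<noteq> 0. representation H v b *\<^sub>R b)"
      using sum_nonzero_representation_eq[OF H(1)] H(2) by simp
    also have "\<dots> = (\<Sum>b\<in>K. representation H v b *\<^sub>R b)"
      using that K by (intro sum.mono_neutral_left) auto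
    finally show ?thesis .
  qed
  have lc: "linear to_completion" by (rule linear_to_completion)
  have key: "(\<Sum>i<k. A (to_completion (delta (u i) (v i))) (h i)) =
      (\<Sum>b\<in>K. A (to_completion (\<Sum>i<k. representation H (h i) b *\<^sub>R delta (u i) (v i))) b)"
    if A: "bilinear A" and h: "\<And>i. i < k \<Longrightarrow> {b. representation H (h i) b \<noteq> 0} \<subseteq> K"
    for A :: "'x lipschitz_free \<Rightarrow> ('e \<Rightarrow>\<^sub>L real) \<Rightarrow> real" and k :: nat and u v h
  proof -
    have A1: "linear (\<lambda>a. A a b)" and A2: "linear (A a)" for a b
      using A by (auto simp: bilinear_def)
    have "(\<Sum>i<k. A (to_completion (delta (u i) (v i))) (h i)) =
      (\<Sum>i<k. \<Sum>b\<in>K. representation H (h i) b * A (to_completion (delta (u i) (v i))) b)"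
    proof (rule sum.cong)
      fix i assume "i \<in> {..<k}"
      then have "h i = (\<Sum>b\<in>K. representation H (h i) b *\<^sub>R b)" using rep h by simp
      then have "A a (h i) = A a (\<Sum>b\<in>K. representation H (h i) b *\<^sub>R b)" for a by simp
      then show "A (to_completion (delta (u i) (v i))) (h i) =
          (\<Sum>b\<in>K. representation H (h i) b * A (to_completion (delta (u i) (v i))) b)"
        by (simp only: linear_sum[OF A2] linear_cmul[OF A2] real_scaleR_def)
    qed simp
    also have "\<dots> = (\<Sum>b\<in>K. \<Sum>i<k. representation H (h i) b * A (to_completion (delta (u i) (v i))) b)"
      by (rule sum.swap)
    also have "\<dots> = (\<Sum>b\<in>K. A (to_completion (\<Sum>i<k. representation H (h i) b *\<^sub>R delta (u i) (v i))) b)"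
      by (simp add: linear_sum[OF lc] linear_cmul[OF lc] linear_sum[OF A1] linear_cmul[OF A1])
    finally show ?thesis .
  qed
  show ?thesis
    unfolding tensor_sum_eq_iff
  proof (intro allI impI)
    fix A :: "'x lipschitz_free \<Rightarrow> ('e \<Rightarrow>\<^sub>L real) \<Rightarrow> real" assume A: "bilinear A"
    show "(\<Sum>i<n. A (to_completion (delta (x i) (y i))) (e i)) =
      (\<Sum>i<m. A (to_completion (delta (x' i) (y' i))) (e' i))"
      using key[OF A, of n e x y] key[OF A, of m e' x' y'] by (force simp: 2 K_def)
  qed
qed

lemma box_to_tensor_sum:
  fixes n :: nat
  shows "box_to_tensor (\<Sum>i<n. box_elem (x i) (y i) (e i)) =
    (\<Sum>i<n. to_completion (delta (x i) (y i)) \<otimes>\<^sub>T e i)"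
  unfolding box_to_tensor_def
proof (rule the_equality, goal_cases)
  case 1
  then show ?case by blast
next
  case (2 v)
  then obtain m :: nat and x' y' e' where
    eq: "(\<Sum>i<n. box_elem (x i) (y i) (e i)) = (\<Sum>i<m. box_elem (x' i) (y' i) (e' i))"
    and v: "v = (\<Sum>i<m. to_completion (delta (x' i) (y' i)) \<otimes>\<^sub>T e' i)"
    by blast
  show ?case unfolding v by (rule box_eq_imp_tensor_eq[OF eq[symmetric]])
qed

definition dpL :: "ereal \<Rightarrow> ('x::pointed_metric_space, 'e::real_normed_vector) box \<Rightarrow> real"
  where "dpL p u = dp p (box_to_tensor u)"

definition strictly_lipschitz_p_summing ::
    "ereal \<Rightarrow> ('x::pointed_metric_space, 'e::banach) lip0 \<Rightarrow> bool"
  where "strictly_lipschitz_p_summing p T \<longleftrightarrow>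
    (\<exists>C>0. \<forall>(n::nat) (x :: nat \<Rightarrow> 'x) (y :: nat \<Rightarrow> 'x) (e :: nat \<Rightarrow> 'e \<Rightarrow>\<^sub>L real).
      \<bar>\<Sum>i<n. blinfun_apply (e i) (lip0_apply T (x i) - lip0_apply T (y i))\<bar>
        \<le> C * dpL p (\<Sum>i<n. box_elem (x i) (y i) (e i)))"

end

theory Submission
  imports Defs
begin

text \<open>
  The linearization \<open>S\<close> of \<open>T\<close> satisfies \<open>S \<delta>\<^bsub>(x,y)\<^esub> = T x - T y\<close>, so the strict Lipschitz inequality is the
  \<open>p\<close>-summing inequality for \<open>S\<close>, restricted to tensors \<open>\<Sum> \<delta>\<^bsub>(x\<^sub>i,y\<^sub>i)\<^esub> \<otimes> e\<^sub>i\<^sup>*\<close>.  One implication is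
  this restriction.

  For the other, moving the scalars of a molecule to the second factor shows that the tensors
  \<open>\<Sum> \<delta>\<^bsub>(x\<^sub>i,y\<^sub>i)\<^esub> \<otimes> e\<^sub>i\<^sup>*\<close> are already all the tensors \<open>\<Sum> m\<^sub>i \<otimes> g\<^sub>i\<close> with molecules \<open>m\<^sub>i\<close>
  (\<open>molecule_tensor_rep\<close>).  The value \<open>\<Sum> \<langle>S m\<^sub>i, g\<^sub>i\<rangle>\<close> depends on the tensor only, since it comes from a
  bilinear map (\<open>evaluation_functional\<close>).  So the hypothesis bounds \<open>S\<close> on the tensors built from
  the dense subspace of molecules, and the bound has to pass to the completion.

  This passage works on representations.  Fix one representation \<open>\<Sum> x\<^sub>i \<otimes> g\<^sub>i\<close> and let
  molecules tend to each \<open>x\<^sub>i\<close> while the \<open>g\<^sub>i\<close> stay.  The norm \<open>d\<^sub>p\<close> of each approximant is at most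
  the product of norms of its obvious representation, and Minkowski's inequality (\<open>lp_norm_triangle\<close>)
  bounds the weak norms of the approximating sequences by that of \<open>x\<close> plus a strong \<open>l\<^sub>p\<close> norm of the
  error, which tends to zero (\<open>weak_lp_norm_perturb\<close>).  In the limit
  \<open>\<bar>\<Sum> \<langle>S x\<^sub>i, g\<^sub>i\<rangle>\<bar> \<le> C \<parallel>x\<parallel>\<^sup>w \<parallel>g\<parallel>\<close> (\<open>dense_bound_imp_bound\<close>).  The infimum over the representations of
  a given tensor then gives \<open>d\<^sub>p\<close> on the right.
\<close>

section \<open>Sequence norms\<close>

lemma lp_norm_nonneg: "0 \<le> lp_norm p n x"
  by (simp add: lp_norm_def)

lemma lp_norm_real:
  "lp_norm (ereal r) n x = (\<Sum>i<n. norm (x i) powr r) powr (1 / r)"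
  by (simp add: lp_norm_def)

lemma sum_powr_le_iff_lp_norm_le:
  assumes "0 < r" "0 \<le> A"
  shows "(\<Sum>i<n. norm (x i) powr r) \<le> A powr r \<longleftrightarrow> lp_norm (ereal r) n x \<le> A"
proof -
  have s: "0 \<le> (\<Sum>i<n. norm (x i) powr r)" by (intro sum_nonneg) simp
  have "(\<Sum>i<n. norm (x i) powr r) = lp_norm (ereal r) n x powr r"
    using assms(1) s by (simp add: lp_norm_real powr_powr)
  moreover have "a powr r \<le> A powr r \<longleftrightarrow> a \<le> A" if "0 \<le> a" for a
    using powr_mono2[of r a A] powr_less_mono2[of r A a] assms that by linarith
  ultimately show ?thesis by (simp only: lp_norm_nonneg)
qed

lemma lp_norm_mono:
  assumes "0 < r" "\<And>i. i < n \<Longrightarrow> norm (x i) \<le> norm (y i)"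
  shows "lp_norm (ereal r) n x \<le> lp_norm (ereal r) n y"
  unfolding lp_norm_real using assms
  by (intro powr_mono2 sum_mono) (auto intro: sum_nonneg)

text \<open>Minkowski's inequality needs convexity of \<open>u \<mapsto> u\<^sup>r\<close> up to the end point \<open>0\<close>, where entries may
  vanish.  There it reduces to \<open>s\<^sup>r \<le> s\<close> for \<open>s\<close> in \<open>[0, 1]\<close>.\<close>

lemma powr_convex_combination:
  fixes u v t r :: real
  assumes r: "1 \<le> r" and t: "0 \<le> t" "t \<le> 1" and uv: "0 \<le> u" "0 \<le> v"
  shows "((1 - t) * u + t * v) powr r \<le> (1 - t) * u powr r + t * v powr r"
proof -
  have 0: "(s * w) powr r \<le> s * w powr r" if "0 \<le> s" "s \<le> 1" "0 \<le> w" for s w :: real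
  proof -
    have "s powr r \<le> s"
      using powr_le_one_le[of s r] r that by (cases "s = 0") auto
    then show ?thesis using that by (simp add: powr_mult mult_right_mono)
  qed
  consider "u = 0" | "v = 0" | "0 < u" "0 < v" using uv by fastforce
  then show ?thesis
  proof cases
    case 1
    then show ?thesis using 0[of t v] t uv by simp
  next
    case 2
    then show ?thesis using 0[of "1 - t" u] t uv by simp
  next
    case 3
    then show ?thesis using convex_onD[OF powr_convex[OF r] t, of u v] by simp
  qed
qed

text \<open>
  Minkowski's inequality, from the convexity of the unit ball: if \<open>\<parallel>x\<parallel> \<le> A\<close> and \<open>\<parallel>y\<parallel> \<le> B\<close>, then
  \<open>(x + y) / (A + B)\<close> is a convex combination of \<open>x / A\<close> and \<open>y / B\<close>, with weights \<open>A / (A + B)\<close> and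
  \<open>B / (A + B)\<close>.
\<close>

lemma lp_norm_triangle:
  fixes x y :: "nat \<Rightarrow> 'f::real_normed_vector"
  assumes r: "1 \<le> r"
  shows "lp_norm (ereal r) n (\<lambda>i. x i + y i) \<le> lp_norm (ereal r) n x + lp_norm (ereal r) n y"
proof (rule field_le_epsilon)
  fix \<epsilon> :: real assume "0 < \<epsilon>"
  \<comment> \<open>The extra \<open>\<epsilon> / 2\<close> keeps the denominators positive when \<open>x\<close> or \<open>y\<close> vanishes.\<close>
  define A where "A = lp_norm (ereal r) n x + \<epsilon> / 2"
  define B where "B = lp_norm (ereal r) n y + \<epsilon> / 2"
  have A: "0 < A" and B: "0 < B"
    using \<open>0 < \<epsilon>\<close> by (simp_all add: A_def B_def add_nonneg_pos lp_norm_nonneg)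
  have r0: "0 < r" using r by simp
  have xA: "(\<Sum>i<n. norm (x i) powr r) \<le> A powr r"
    and yB: "(\<Sum>i<n. norm (y i) powr r) \<le> B powr r"
    using A B \<open>0 < \<epsilon>\<close> r0 by (simp_all add: sum_powr_le_iff_lp_norm_le A_def B_def)
  define t where "t = B / (A + B)"
  have t: "0 \<le> t" "t \<le> 1" "1 - t = A / (A + B)"
    using A B by (simp_all add: t_def field_simps)
  have pt: "norm (x i + y i) powr r \<le>
      (A + B) powr r * ((1 - t) * (norm (x i) powr r / A powr r) + t * (norm (y i) powr r / B powr r))"
    for i
  proof -
    have "norm (x i + y i) powr r \<le> ((A + B) * ((1 - t) * (norm (x i) / A) + t * (norm (y i) / B))) powr r"
    proof (rule powr_mono2)
      have "(A + B) * ((1 - t) * (norm (x i) / A) + t * (norm (y i) / B)) = norm (x i) + norm (y i)"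
        unfolding t(3) using A B by (simp add: t_def distrib_left)
      then show "norm (x i + y i) \<le> (A + B) * ((1 - t) * (norm (x i) / A) + t * (norm (y i) / B))"
        using norm_triangle_ineq[of "x i" "y i"] by simp
    qed (use r0 in simp_all)
    also have "\<dots> = (A + B) powr r * ((1 - t) * (norm (x i) / A) + t * (norm (y i) / B)) powr r"
      by (rule powr_mult)
    also have "\<dots> \<le> (A + B) powr r * ((1 - t) * (norm (x i) / A) powr r + t * (norm (y i) / B) powr r)"
      using A B by (intro mult_left_mono powr_convex_combination r t(1,2)) auto
    finally show ?thesis using A B by (simp add: powr_divide)
  qed
  have "(\<Sum>i<n. norm (x i + y i) powr r) \<le> (\<Sum>i<n. (A + B) powr r *
      ((1 - t) * (norm (x i) powr r / A powr r) + t * (norm (y i) powr r / B powr r)))"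
    by (intro sum_mono pt)
  also have "\<dots> = (A + B) powr r * ((1 - t) * ((\<Sum>i<n. norm (x i) powr r) / A powr r) +
      t * ((\<Sum>i<n. norm (y i) powr r) / B powr r))"
    by (simp add: sum_distrib_left sum.distrib sum_divide_distrib algebra_simps)
  also have "\<dots> \<le> (A + B) powr r * ((1 - t) * 1 + t * 1)"
    using xA yB A B t(1,2) by (intro mult_left_mono add_mono) auto
  finally have "(\<Sum>i<n. norm (x i + y i) powr r) \<le> (A + B) powr r" by simp
  then have "lp_norm (ereal r) n (\<lambda>i. x i + y i) \<le> A + B"
    using A B r0 by (subst sum_powr_le_iff_lp_norm_le[symmetric]) auto
  then show "lp_norm (ereal r) n (\<lambda>i. x i + y i) \<le> lp_norm (ereal r) n x + lp_norm (ereal r) n y + \<epsilon>"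
    by (simp add: A_def B_def)
qed

lemma lp_norm_tendsto_0:
  fixes x :: "nat \<Rightarrow> nat \<Rightarrow> 'f::real_normed_vector"
  assumes r: "0 < r" and x: "\<And>i. (\<lambda>k. x k i) \<longlonglongrightarrow> 0"
  shows "(\<lambda>k. lp_norm (ereal r) n (x k)) \<longlonglongrightarrow> 0"
proof -
  have "(\<lambda>k. \<Sum>i<n. norm (x k i) powr r) \<longlonglongrightarrow> (\<Sum>i<n. 0)"
    by (intro tendsto_sum tendsto_zero_powrI[OF tendsto_norm_zero[OF x] tendsto_const]) (use r in auto)
  then have "(\<lambda>k. \<Sum>i<n. norm (x k i) powr r) \<longlonglongrightarrow> 0" by simp
  then show ?thesis
    unfolding lp_norm_real
    by (rule tendsto_zero_powrI[OF _ tendsto_const]) (use r in \<open>auto intro!: always_eventually sum_nonneg\<close>)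
qed

lemma lp_norm_functional_le:
  fixes x :: "nat \<Rightarrow> 'f::real_normed_vector" and \<phi> :: "'f \<Rightarrow>\<^sub>L real"
  assumes "0 < r" "norm \<phi> \<le> 1"
  shows "lp_norm (ereal r) n (\<lambda>i. \<phi> (x i)) \<le> lp_norm (ereal r) n x"
proof (rule lp_norm_mono[OF assms(1)])
  fix i
  have "norm (\<phi> (x i)) \<le> norm \<phi> * norm (x i)" by (rule norm_blinfun)
  also have "\<dots> \<le> 1 * norm (x i)" using assms(2) by (intro mult_right_mono) auto
  finally show "norm (\<phi> (x i)) \<le> norm (x i)" by simp
qed

text \<open>The supremum defining the weak norm is one of reals, so it bounds its members only because the
  strong norm bounds them all.\<close>

lemma weak_lp_norm_upper:
  fixes x :: "nat \<Rightarrow> 'f::real_normed_vector" and \<phi> :: "'f \<Rightarrow>\<^sub>L real"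
  assumes "0 < r" "norm \<phi> \<le> 1"
  shows "lp_norm (ereal r) n (\<lambda>i. \<phi> (x i)) \<le> weak_lp_norm (ereal r) n x"
  unfolding weak_lp_norm_def
proof (rule cSUP_upper)
  show "bdd_above ((\<lambda>\<phi>. lp_norm (ereal r) n (\<lambda>i. blinfun_apply \<phi> (x i))) `
      {\<phi> :: 'f \<Rightarrow>\<^sub>L real. norm \<phi> \<le> 1})"
    by (rule bdd_aboveI2, rule lp_norm_functional_le[OF assms(1)]) simp
qed (use assms in simp)

lemma weak_lp_norm_nonneg:
  assumes "0 < r"
  shows "0 \<le> weak_lp_norm (ereal r) n x"
  using order_trans[OF lp_norm_nonneg weak_lp_norm_upper[OF assms, of 0 n x]] by simp

text \<open>The error is measured in the strong norm, because that is the one that tends to zero when each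
  of the finitely many entries does.\<close>

lemma weak_lp_norm_perturb:
  fixes x y :: "nat \<Rightarrow> 'f::real_normed_vector"
  assumes r: "1 \<le> r"
  shows "weak_lp_norm (ereal r) n y \<le>
    weak_lp_norm (ereal r) n x + lp_norm (ereal r) n (\<lambda>i. y i - x i)"
proof -
  have r0: "0 < r" using r by simp
  show ?thesis
    unfolding weak_lp_norm_def[of _ n y]
  proof (rule cSUP_least)
    show "{\<phi> :: 'f \<Rightarrow>\<^sub>L real. norm \<phi> \<le> 1} \<noteq> {}" by (auto intro: exI[of _ 0])
    fix \<phi> :: "'f \<Rightarrow>\<^sub>L real" assume "\<phi> \<in> {\<phi>. norm \<phi> \<le> 1}"
    then have \<phi>: "norm \<phi> \<le> 1" by simp
    have "lp_norm (ereal r) n (\<lambda>i. \<phi> (y i)) = lp_norm (ereal r) n (\<lambda>i. \<phi> (x i) + \<phi> (y i - x i))"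
      by (simp add: blinfun.diff_right)
    also have "\<dots> \<le> lp_norm (ereal r) n (\<lambda>i. \<phi> (x i)) + lp_norm (ereal r) n (\<lambda>i. \<phi> (y i - x i))"
      by (rule lp_norm_triangle[OF r])
    also have "\<dots> \<le> weak_lp_norm (ereal r) n x + lp_norm (ereal r) n (\<lambda>i. y i - x i)"
      by (intro add_mono weak_lp_norm_upper lp_norm_functional_le r0 \<phi>)
    finally show "lp_norm (ereal r) n (\<lambda>i. \<phi> (y i)) \<le> \<dots>" .
  qed
qed

section \<open>The norm \<open>d\<^sub>p\<close> and tensors of molecules\<close>

lemma dp_le:
  fixes x :: "nat \<Rightarrow> 'f::real_normed_vector" and g :: "nat \<Rightarrow> 'g::real_normed_vector"
  assumes "0 < r"
  shows "dp (ereal r) (\<Sum>i<n. x i \<otimes>\<^sub>T g i) \<le>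
    weak_lp_norm (ereal r) n x * lp_norm (conj_exp (ereal r)) n g"
  unfolding dp_def
proof (rule cInf_lower)
  let ?P = "{weak_lp_norm (ereal r) k y * lp_norm (conj_exp (ereal r)) k h | k y h.
    (\<Sum>i<n. x i \<otimes>\<^sub>T g i) = (\<Sum>i<k. y i \<otimes>\<^sub>T h i)}"
  show "weak_lp_norm (ereal r) n x * lp_norm (conj_exp (ereal r)) n g \<in> ?P" by blast
  show "bdd_below ?P"
  proof (rule bdd_belowI[of _ 0])
    fix z assume "z \<in> ?P"
    then obtain k and y :: "nat \<Rightarrow> 'f" and h :: "nat \<Rightarrow> 'g" where "z = weak_lp_norm (ereal r) k y * lp_norm (conj_exp (ereal r)) k h"
      by blast
    then show "0 \<le> z" by (simp only: mult_nonneg_nonneg weak_lp_norm_nonneg[OF assms] lp_norm_nonneg)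
  qed
qed

lemma dp_greatest:
  assumes "\<And>(n::nat) x g. u = (\<Sum>i<n. x i \<otimes>\<^sub>T g i) \<Longrightarrow>
    z \<le> weak_lp_norm p n x * lp_norm (conj_exp p) n g"
  shows "z \<le> dp p u"
proof -
  obtain n :: nat and x g where "u = (\<Sum>i<n. x i \<otimes>\<^sub>T g i)" by (rule tensor_rep)
  then show ?thesis unfolding dp_def using assms by (intro cInf_greatest) blast+
qed

text \<open>Tensors \<open>\<delta>\<^bsub>(x,y)\<^esub> \<otimes> e\<close> are stable under scalars, as these can be absorbed into \<open>e\<close>; hence their
  span consists of plain sums, and it contains \<open>m \<otimes> g\<close> for every molecule \<open>m\<close>.\<close>

lemma molecule_tensor_rep:
  fixes m :: "nat \<Rightarrow> 'x::pointed_metric_space molecule" and g :: "nat \<Rightarrow> 'g::real_normed_vector"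
  obtains N :: nat and x y h where
    "(\<Sum>i<n. to_completion (m i) \<otimes>\<^sub>T g i) =
      (\<Sum>j<N. to_completion (delta (x j) (y j)) \<otimes>\<^sub>T (h j :: 'g))"
proof -
  let ?D = "range (\<lambda>(x::'x, y, e::'g). to_completion (delta x y) \<otimes>\<^sub>T e)"
  have lt: "linear (to_completion :: 'x molecule \<Rightarrow> _)" by (rule linear_to_completion)
  have D: "to_completion (delta a b) \<otimes>\<^sub>T e \<in> ?D" for a b e
    by (rule image_eqI[of _ _ "(a, b, e)"]) simp_all
  have "to_completion (m i) \<otimes>\<^sub>T g i \<in> span ?D" for i
  proof -
    obtain k :: nat and c x y where mi: "m i = (\<Sum>j<k. c j *\<^sub>R delta (x j) (y j))"
      by (rule molecule_rep)
    have "to_completion (m i) \<otimes>\<^sub>T g i = (\<Sum>j<k. c j *\<^sub>R (to_completion (delta (x j) (y j)) \<otimes>\<^sub>T g i))"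
      by (simp add: mi linear_sum[OF lt] linear_cmul[OF lt] linear_sum[OF tensor_elem_linear(1)]
          linear_cmul[OF tensor_elem_linear(1)])
    also have "\<dots> \<in> span ?D" by (intro span_sum span_scale span_base D)
    finally show ?thesis .
  qed
  then have "(\<Sum>i<n. to_completion (m i) \<otimes>\<^sub>T g i) \<in> span ?D" by (intro span_sum)
  then have "\<exists>(N::nat) x y h. (\<Sum>i<n. to_completion (m i) \<otimes>\<^sub>T g i) =
      (\<Sum>j<N. to_completion (delta (x j) (y j)) \<otimes>\<^sub>T h j)"
  proof (induction rule: span_induct_alt)
    case base
    then show ?case by (intro exI[of _ 0]) simp
  next
    case (step c d v)
    then obtain N x y h where v: "v = (\<Sum>j<(N::nat). to_completion (delta (x j) (y j)) \<otimes>\<^sub>T h j)"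
      by blast
    obtain a b e where d: "d = to_completion (delta a b) \<otimes>\<^sub>T e" using step by auto
    have "c *\<^sub>R d + v = (\<Sum>j<Suc N. to_completion (delta ((x(N := a)) j) ((y(N := b)) j)) \<otimes>\<^sub>T
        (h(N := c *\<^sub>R e)) j)"
      by (simp add: v d linear_cmul[OF tensor_elem_linear(2)] add.commute)
    then show ?case by blast
  qed
  then show ?thesis using that by blast
qed

section \<open>Linearization and the summing inequality\<close>

lemma linearization_delta:
  "linearization T (to_completion (delta x y)) = lip0_apply T x - lip0_apply T y"
proof -
  have "to_completion (delta x y) = delta_X x - delta_X y"
    unfolding delta_X_def
    by (subst delta_eq_diff) (rule linear_diff[OF linear_to_completion])
  then show ?thesis by (simp add: blinfun.diff_right linearization_apply)
qed

text \<open>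
  The right-hand side of the conclusion refers to the representation \<open>(x, g)\<close> and not to
  \<open>d\<^sub>p\<close> of the tensor: for a fixed representation only the weak norm of \<open>x\<close> has to be controlled in
  the limit, and the passage to \<open>d\<^sub>p\<close> is an infimum taken afterwards.
\<close>

lemma dense_bound_imp_bound:
  fixes S :: "'a::real_normed_vector completion \<Rightarrow>\<^sub>L 'e::real_normed_vector"
    and g :: "nat \<Rightarrow> 'e \<Rightarrow>\<^sub>L real"
  assumes r: "1 \<le> r" and C: "0 \<le> C"
    and bound: "\<And>m. \<bar>\<Sum>i<n. g i (S (to_completion (m i)))\<bar> \<le>
      C * dp (ereal r) (\<Sum>i<n. to_completion (m i) \<otimes>\<^sub>T g i)"
  shows "\<bar>\<Sum>i<n. g i (S (x i))\<bar> \<le>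
    C * (weak_lp_norm (ereal r) n x * lp_norm (conj_exp (ereal r)) n g)"
proof -
  have r0: "0 < r" using r by simp
  have "\<exists>X. (\<lambda>k. to_completion (X k)) \<longlonglongrightarrow> x i" for i
    by (rule completion_limit[of "x i"]) blast
  then obtain X where X: "\<And>i. (\<lambda>k. to_completion (X i k)) \<longlonglongrightarrow> x i" by metis
  let ?w = "weak_lp_norm (ereal r) n x" and ?G = "lp_norm (conj_exp (ereal r)) n g"
  let ?\<epsilon> = "\<lambda>k. lp_norm (ereal r) n (\<lambda>i. to_completion (X i k) - x i)"
  have 1: "(\<lambda>k. \<bar>\<Sum>i<n. g i (S (to_completion (X i k)))\<bar>) \<longlonglongrightarrow> \<bar>\<Sum>i<n. g i (S (x i))\<bar>"
    by (intro tendsto_rabs tendsto_sum bounded_linear.tendsto[OF blinfun.bounded_linear_right] X)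
  have "(\<lambda>k. ?\<epsilon> k) \<longlonglongrightarrow> 0"
    using X by (intro lp_norm_tendsto_0[OF r0]) (simp add: LIM_zero_iff)
  then have "(\<lambda>k. C * ((?w + ?\<epsilon> k) * ?G)) \<longlonglongrightarrow> C * ((?w + 0) * ?G)"
    by (intro tendsto_intros)
  then have 2: "(\<lambda>k. C * ((?w + ?\<epsilon> k) * ?G)) \<longlonglongrightarrow> C * (?w * ?G)" by simp
  have 3: "\<bar>\<Sum>i<n. g i (S (to_completion (X i k)))\<bar> \<le> C * ((?w + ?\<epsilon> k) * ?G)" for k
  proof -
    have "dp (ereal r) (\<Sum>i<n. to_completion (X i k) \<otimes>\<^sub>T g i) \<le>
        weak_lp_norm (ereal r) n (\<lambda>i. to_completion (X i k)) * ?G"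
      by (rule dp_le[OF r0])
    also have "\<dots> \<le> (?w + ?\<epsilon> k) * ?G"
      by (intro mult_right_mono weak_lp_norm_perturb[OF r] lp_norm_nonneg)
    finally show ?thesis
      using order_trans[OF bound[of "\<lambda>i. X i k"] mult_left_mono[OF _ C]] by blast
  qed
  show ?thesis by (rule LIMSEQ_le[OF 1 2]) (use 3 in blast)
qed

text \<open>Used to compare \<open>\<Sum> \<langle>S x\<^sub>i, g\<^sub>i\<rangle>\<close> along two representations of one tensor.\<close>

lemma evaluation_functional:
  fixes S :: "'f::real_normed_vector \<Rightarrow>\<^sub>L 'e::real_normed_vector"
  obtains \<Lambda> :: "('f, 'e \<Rightarrow>\<^sub>L real) tensor \<Rightarrow> real"
  where "\<And>(n::nat) x g. \<Lambda> (\<Sum>i<n. x i \<otimes>\<^sub>T g i) = (\<Sum>i<n. g i (S (x i)))"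
proof -
  have "bilinear (\<lambda>a (g :: 'e \<Rightarrow>\<^sub>L real). g (S a))"
    unfolding bilinear_def
    by (auto intro!: linearI simp: blinfun.add_right blinfun.add_left blinfun.scaleR_right
        blinfun.scaleR_left)
  then obtain \<Lambda> :: "('f, 'e \<Rightarrow>\<^sub>L real) tensor \<Rightarrow> real"
    where \<Lambda>: "linear \<Lambda>" "\<And>a g. \<Lambda> (a \<otimes>\<^sub>T g) = blinfun_apply g (S a)"
    using tensor_universal by blast
  then show ?thesis by (intro that[of \<Lambda>]) (simp add: linear_sum[OF \<Lambda>(1)] \<Lambda>(2))
qed

theorem theorem3p5:
  fixes p :: ereal and T :: "('x::pointed_metric_space, 'e::banach) lip0"
  assumes "1 \<le> p" and "p < \<infinity>"
  shows "strictly_lipschitz_p_summing p T \<longleftrightarrow> p_summing p (blinfun_apply (linearization T))"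
proof
  obtain r where p: "p = ereal r" and r: "1 \<le> r" using assms by (cases p) auto
  let ?S = "linearization T"
  obtain \<Lambda> :: "('x lipschitz_free, 'e \<Rightarrow>\<^sub>L real) tensor \<Rightarrow> real"
    where \<Lambda>: "\<And>(n::nat) x g. \<Lambda> (\<Sum>i<n. x i \<otimes>\<^sub>T g i) = (\<Sum>i<n. g i (?S (x i)))"
    using evaluation_functional by blast
  assume "strictly_lipschitz_p_summing p T"
  then obtain C where C: "0 < C" and *: "\<And>(n::nat) x y (e :: nat \<Rightarrow> 'e \<Rightarrow>\<^sub>L real).
      \<bar>\<Sum>i<n. blinfun_apply (e i) (lip0_apply T (x i) - lip0_apply T (y i))\<bar>
        \<le> C * dpL p (\<Sum>i<n. box_elem (x i) (y i) (e i))"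
    unfolding strictly_lipschitz_p_summing_def by blast
  have mol: "\<bar>\<Sum>i<n. g i (?S (to_completion (m i)))\<bar> \<le> C * dp p (\<Sum>i<n. to_completion (m i) \<otimes>\<^sub>T g i)"
    for n :: nat and m and g :: "nat \<Rightarrow> 'e \<Rightarrow>\<^sub>L real"
  proof -
    obtain N x y e where u: "(\<Sum>i<n. to_completion (m i) \<otimes>\<^sub>T g i) =
        (\<Sum>j<(N::nat). to_completion (delta (x j) (y j)) \<otimes>\<^sub>T e j)"
      by (rule molecule_tensor_rep)
    have "(\<Sum>i<n. g i (?S (to_completion (m i)))) =
        (\<Sum>j<N. e j (lip0_apply T (x j) - lip0_apply T (y j)))"
      using arg_cong[OF u, of \<Lambda>] by (simp add: \<Lambda> linearization_delta)
    then show ?thesis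
      using *[where n = N and x = x and y = y and e = e] by (simp add: u dpL_def box_to_tensor_sum)
  qed
  have "\<bar>\<Sum>i<n. g i (?S (x i))\<bar> \<le> C * dp p (\<Sum>i<n. x i \<otimes>\<^sub>T g i)"
    for n :: nat and x and g :: "nat \<Rightarrow> 'e \<Rightarrow>\<^sub>L real"
  proof -
    \<comment> \<open>Every representation of the tensor gives the same value of \<open>\<Lambda>\<close>, so the bound for each
      representation bounds the infimum.\<close>
    have "\<bar>\<Sum>i<n. g i (?S (x i))\<bar> / C \<le> dp p (\<Sum>i<n. x i \<otimes>\<^sub>T g i)"
    proof (rule dp_greatest)
      fix k :: nat and z and h :: "nat \<Rightarrow> 'e \<Rightarrow>\<^sub>L real"
      assume "(\<Sum>i<n. x i \<otimes>\<^sub>T g i) = (\<Sum>i<k. z i \<otimes>\<^sub>T h i)"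
      then have "(\<Sum>i<n. g i (?S (x i))) = (\<Sum>i<k. h i (?S (z i)))"
        unfolding \<Lambda>[symmetric] by (rule arg_cong)
      moreover have "\<bar>\<Sum>i<k. h i (?S (z i))\<bar> \<le> C * (weak_lp_norm p k z * lp_norm (conj_exp p) k h)"
        unfolding p using r C mol by (intro dense_bound_imp_bound) (auto simp: p)
      ultimately show "\<bar>\<Sum>i<n. g i (?S (x i))\<bar> / C \<le> weak_lp_norm p k z * lp_norm (conj_exp p) k h"
        using C by (simp add: field_simps)
    qed
    then show ?thesis using C by (simp add: field_simps)
  qed
  then show "p_summing p ?S"
    unfolding p_summing_def
    using C by (blast intro: bounded_linear.linear blinfun.bounded_linear_right)
next
  assume "p_summing p (linearization T)"
  then obtain C where C: "0 < C" and *: "\<And>(n::nat) x (g :: nat \<Rightarrow> 'e \<Rightarrow>\<^sub>L real).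
      \<bar>\<Sum>i<n. blinfun_apply (g i) (linearization T (x i))\<bar> \<le> C * dp p (\<Sum>i<n. x i \<otimes>\<^sub>T g i)"
    unfolding p_summing_def by blast
  have "\<bar>\<Sum>i<n. blinfun_apply (e i) (lip0_apply T (x i) - lip0_apply T (y i))\<bar>
      \<le> C * dpL p (\<Sum>i<n. box_elem (x i) (y i) (e i))"
    for n :: nat and x y and e :: "nat \<Rightarrow> 'e \<Rightarrow>\<^sub>L real"
    using *[where n = n and g = e and x = "\<lambda>i. to_completion (delta (x i) (y i))"]
    by (simp add: linearization_delta dpL_def box_to_tensor_sum)
  then show "strictly_lipschitz_p_summing p T"
    unfolding strictly_lipschitz_p_summing_def using C by blast
qed

end
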